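(* Let $n\ge1$, let $\lambda$ be a partition with at most $n$ parts, $\delta=(n,n-1,\ldots,1)$ and $\mu=\lambda+\delta$. There exists a bijection $\Phi:\mathcal{QST}^\mu(n,\overline{n})\to\mathcal{QD}^\delta(n,\overline{n})\times\mathcal{T}^\lambda(n,\overline{n})$ such that whenever $\Phi(S)=(D,T)$ we have ${\rm wgt}(S)={\rm wgt}(D)+{\rm wgt}(T)$ and ${\rm bar}(S)={\rm bar}(D)+{\rm bar}(T)$.
   Context: Use the alphabet $\{\overline{1}',\overline{1},1',1,\ldots,\overline{n}',\overline{n},n',n\}$ totally ordered by $\overline{1}'<\overline{1}<1'<1<\overline{2}'<\overline{2}<2'<2<\cdots<\overline{n}'<\overline{n}<n'<n$; entries $k',\overline{k}'$ are primed, entries $\overline{k},\overline{k}'$ are barred. For a strict partition $\mu=(\mu_1>\cdots>\mu_n>0)$ the shifted diagram is the set of boxes $(i,j)$, $1\le i\le n$, $i\le j\le i+\mu_i-1$. $\mathcal{QST}^\mu(n,\overline{n})$ is the set of fillings of the shifted diagram with entries from this alphabet such that rows weakly increase left to right, columns weakly increase top to bottom, no unprimed entry occurs twice in a column, no primed entry occurs twice in a row, and the entry in box $(k,k)$ lies in $\{\overline{k}',\overline{k},k',k\}$ for every $k$. The shifted diagram of $\delta$ consists of boxes $(i,j)$, $1\le i\le j\le n$; $\mathcal{QD}^\delta(n,\overline{n})$ is the set of fillings of it in which each box $(i,j)$ contains one of $i,\overline{i},j',\overline{j}'$ (unprimed $k,\overline{k}$ only in row $k$, primed $k',\overline{k}'$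 only in column $k$). $\mathcal{T}^\lambda(n,\overline{n})$ is the set of fillings of the Young diagram of $\lambda$ with entries from $\{\overline{1},1,\ldots,\overline{n},n\}$ (ordered $\overline{1}<1<\cdots<\overline{n}<n$) with rows weakly increasing, columns strictly increasing, and each entry in row $i$ at least $\overline{i}$. For any such filling $F$, ${\rm bar}(F)$ is the number of barred entries and ${\rm wgt}(F)=({\bf u}/{\bf v})$ with $u_k=n_k-n_{\overline{k}}$ and $v_k=n_{k'}-n_{\overline{k}'}$, where $n_e$ is the number of entries equal to $e$ (so for $T\in\mathcal{T}^\lambda(n,\overline{n})$, ${\bf v}=0$). Weights are added componentwise. *)

theory Defs
  imports Main "HOL-Library.Function_Algebras" "HOL-Library.Product_Plus"
begin

section \<open>The alphabet\<close>

datatype letter = Letter (idx: nat) (barred: bool) (primed: bool)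

abbreviation plainL :: "nat \<Rightarrow> letter" where "plainL k \<equiv> Letter k False False"
abbreviation barL :: "nat \<Rightarrow> letter" where "barL k \<equiv> Letter k True False"
abbreviation primeL :: "nat \<Rightarrow> letter" where "primeL k \<equiv> Letter k False True"
abbreviation barprimeL :: "nat \<Rightarrow> letter" where "barprimeL k \<equiv> Letter k True True"

fun letter_rank :: "letter \<Rightarrow> nat" where
  "letter_rank (Letter k b p) = 4 * k + (if b then 0 else 2) + (if p then 0 else 1)"

lemma letter_rank_inject: "letter_rank x = letter_rank y \<longleftrightarrow> x = y"
  by (cases x; cases y) (auto split: if_splits, presburger+)

instantiation letter :: linorder
begin

definition less_eq_letter :: "letter \<Rightarrow> letter \<Rightarrow> bool" where
  "x \<le> y \<longleftrightarrow> letter_rank x \<le> letter_rank y"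

definition less_letter :: "letter \<Rightarrow> letter \<Rightarrow> bool" where
  "x < y \<longleftrightarrow> letter_rank x < letter_rank y"

instance
  by standard (auto simp: less_eq_letter_def less_letter_def letter_rank_inject[symmetric])

end

lemma letter_order:
  "barprimeL k < barL k" "barL k < primeL k" "primeL k < plainL k" "plainL k < barprimeL (Suc k)"
  by (simp_all add: less_letter_def)

definition alphabet :: "nat \<Rightarrow> letter set" where
  "alphabet n = {x. 1 \<le> idx x \<and> idx x \<le> n}"


section \<open>Partitions and diagrams\<close>

text \<open>A partition is the list of its (positive) parts.\<close>

definition is_partition :: "nat list \<Rightarrow> bool" where
  "is_partition lam \<longleftrightarrow> sorted_wrt (\<ge>) lam \<and> (\<forall>x \<in> set lam. 0 < x)"

definition is_strict_partition :: "nat list \<Rightarrow> bool" where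
  "is_strict_partition mu \<longleftrightarrow> sorted_wrt (>) mu \<and> (\<forall>x \<in> set mu. 0 < x)"

text \<open>Parts are numbered from 1 and padded by zeros.\<close>

definition part :: "nat list \<Rightarrow> nat \<Rightarrow> nat" where
  "part lam i = (if 1 \<le> i \<and> i \<le> length lam then lam ! (i - 1) else 0)"

definition add_partition :: "nat list \<Rightarrow> nat list \<Rightarrow> nat list" where
  "add_partition lam mu =
     map (\<lambda>i. part lam i + part mu i) [1..<Suc (max (length lam) (length mu))]"

definition staircase :: "nat \<Rightarrow> nat list" where
  "staircase n = rev [1..<Suc n]"

definition young_diagram :: "nat list \<Rightarrow> (nat \<times> nat) set" where
  "young_diagram lam = {(i, j). 1 \<le> i \<and> i \<le> length lam \<and> 1 \<le> j \<and> j \<le> part lam i}"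

definition shifted_diagram :: "nat list \<Rightarrow> (nat \<times> nat) set" where
  "shifted_diagram mu =
     {(i, j). 1 \<le> i \<and> i \<le> length mu \<and> i \<le> j \<and> j + 1 \<le> i + part mu i}"

lemma length_staircase [simp]: "length (staircase n) = n"
  by (simp add: staircase_def)

lemma part_staircase: "1 \<le> i \<Longrightarrow> i \<le> n \<Longrightarrow> part (staircase n) i = Suc n - i"
  by (simp add: part_def staircase_def rev_nth del: upt_Suc)

lemma shifted_diagram_staircase:
  "shifted_diagram (staircase n) = {(i, j). 1 \<le> i \<and> i \<le> j \<and> j \<le> n}"
  by (auto simp: shifted_diagram_def part_staircase)

lemma length_add_staircase:
  "length lam \<le> n \<Longrightarrow> length (add_partition lam (staircase n)) = n"
  by (simp add: add_partition_def)

lemma part_add_staircase: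
  assumes "length lam \<le> n" "1 \<le> i" "i \<le> n"
  shows "part (add_partition lam (staircase n)) i = part lam i + (Suc n - i)"
proof -
  have "[1..<Suc n] ! (i - 1) = i"
    using assms(2,3) by (subst nth_upt) auto
  then have "part (add_partition lam (staircase n)) i
      = part lam i + part (staircase n) i"
    using assms
    by (subst part_def) (simp add: add_partition_def del: upt_Suc)
  then show ?thesis using assms by (simp add: part_staircase)
qed

lemma is_strict_partition_add_staircase:
  assumes "is_partition lam" "length lam \<le> n"
  shows "is_strict_partition (add_partition lam (staircase n))"
proof -
  let ?mu = "add_partition lam (staircase n)"
  have len: "length ?mu = n" by (rule length_add_staircase[OF assms(2)])
  have nth: "?mu ! i = part lam (Suc i) + (n - i)" if "i < n" for i
    using part_add_staircase[OF assms(2), of "Suc i"] that len by (simp add: part_def)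
  have le: "part lam (Suc j) \<le> part lam (Suc i)" if "i < j" for i j
    using assms(1) that by (auto simp: part_def is_partition_def sorted_wrt_iff_nth_less)
  have "?mu ! j < ?mu ! i" if "i < j" "j < n" for i j
    using nth[of i] nth[of j] le[OF that(1)] that by simp
  moreover have "0 < ?mu ! i" if "i < n" for i
    using nth[OF that] that by simp
  ultimately show ?thesis
    by (auto simp: is_strict_partition_def sorted_wrt_iff_nth_less len in_set_conv_nth)
qed


section \<open>Fillings\<close>

text \<open>A filling is a partial map from boxes to letters whose domain is the diagram.\<close>

type_synonym filling = "nat \<times> nat \<rightharpoonup> letter"

definition fillings :: "(nat \<times> nat) set \<Rightarrow> letter set \<Rightarrow> filling set" where
  "fillings B A = {F. dom F = B \<and> ran F \<subseteq> A}"

definition rows_weakly_increase :: "filling \<Rightarrow> bool" where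
  "rows_weakly_increase F \<longleftrightarrow>
     (\<forall>i j j' x y. j < j' \<longrightarrow> F (i, j) = Some x \<longrightarrow> F (i, j') = Some y \<longrightarrow> x \<le> y)"

definition columns_weakly_increase :: "filling \<Rightarrow> bool" where
  "columns_weakly_increase F \<longleftrightarrow>
     (\<forall>i i' j x y. i < i' \<longrightarrow> F (i, j) = Some x \<longrightarrow> F (i', j) = Some y \<longrightarrow> x \<le> y)"

definition columns_strictly_increase :: "filling \<Rightarrow> bool" where
  "columns_strictly_increase F \<longleftrightarrow>
     (\<forall>i i' j x y. i < i' \<longrightarrow> F (i, j) = Some x \<longrightarrow> F (i', j) = Some y \<longrightarrow> x < y)"

definition no_unprimed_twice_in_column :: "filling \<Rightarrow> bool" where
  "no_unprimed_twice_in_column F \<longleftrightarrow>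
     (\<forall>i i' j x. F (i, j) = Some x \<longrightarrow> F (i', j) = Some x \<longrightarrow> \<not> primed x \<longrightarrow> i = i')"

definition no_primed_twice_in_row :: "filling \<Rightarrow> bool" where
  "no_primed_twice_in_row F \<longleftrightarrow>
     (\<forall>i j j' x. F (i, j) = Some x \<longrightarrow> F (i, j') = Some x \<longrightarrow> primed x \<longrightarrow> j = j')"

definition QST :: "nat \<Rightarrow> nat list \<Rightarrow> filling set" where
  "QST n mu = {F \<in> fillings (shifted_diagram mu) (alphabet n).
     rows_weakly_increase F \<and> columns_weakly_increase F \<and>
     no_unprimed_twice_in_column F \<and> no_primed_twice_in_row F \<and>
     (\<forall>k x. F (k, k) = Some x \<longrightarrow> x \<in> {barprimeL k, barL k, primeL k, plainL k})}"

definition QD :: "nat \<Rightarrow> filling set" where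
  "QD n = {F \<in> fillings (shifted_diagram (staircase n)) (alphabet n).
     \<forall>i j x. F (i, j) = Some x \<longrightarrow> x \<in> {plainL i, barL i, primeL j, barprimeL j}}"

definition ST :: "nat \<Rightarrow> nat list \<Rightarrow> filling set" where
  "ST n lam = {F \<in> fillings (young_diagram lam) {x \<in> alphabet n. \<not> primed x}.
     rows_weakly_increase F \<and> columns_strictly_increase F \<and>
     (\<forall>i j x. F (i, j) = Some x \<longrightarrow> barL i \<le> x)}"


section \<open>Statistics\<close>

definition num_entries :: "filling \<Rightarrow> letter \<Rightarrow> nat" where
  "num_entries F e = card {b. F b = Some e}"

definition bar_count :: "filling \<Rightarrow> nat" where
  "bar_count F = card {b. \<exists>x. F b = Some x \<and> barred x}"

text \<open>
  The two components are the vectors u and v.  They are total functions of the index, and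
  vanish outside 1, ..., n for fillings over the alphabet of size n.
\<close>

definition wgt :: "filling \<Rightarrow> (nat \<Rightarrow> int) \<times> (nat \<Rightarrow> int)" where
  "wgt F = (\<lambda>k. int (num_entries F (plainL k)) - int (num_entries F (barL k)),
            \<lambda>k. int (num_entries F (primeL k)) - int (num_entries F (barprimeL k)))"

end

theory Submission
  imports Defs "Jordan_Normal_Form.Determinant" "HOL-Computational_Algebra.Formal_Laurent_Series"
begin

text \<open>
  A bijection respecting the weights exists as soon as the weight generating functions agree; the
  number of barred entries then takes care of itself, because the total number of entries is fixed
  and the sum of all weight components is this number minus twice the number of barred entries.

  Give a letter and its barred version inverse weights, and peel the letters off in decreasing
  order. Removing a letter removes a strip, and summing over strips amounts to multiplying the
  columns of a determinant of power series coefficients by 1/(1 - xq) for an unprimed letter and by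
  1 + yq for a primed one, where q is the formal variable; the first letters of each index add a
  row and a column. So both tableau sums are determinants, with columns
  \<open>\<Prod>k>j. A k / B k\<close> for shifted and \<open>q ^ (n - j) * (\<Prod>k>j. 1 / B k)\<close> for symplectic tableaux, where
  \<open>A k = 1 + Y k * q + q\<^sup>2\<close>, \<open>B k = 1 - X k * q + q\<^sup>2\<close>, and X k, Y k are the sums of the weights of
  the two unprimed, respectively primed, letters of index k. Since A k - B j = (X j + Y k) q, the
  first system of columns is a triangular combination of the second one and the constants, with
  diagonal entries \<open>\<Prod>k>j. X (j + 1) + Y k\<close>. Their product is the generating function of the
  fillings of the staircase.
\<close>

section \<open>Determinants of power series coefficients\<close>

text \<open>A Jacobi-Trudi type matrix: row i reads the column series at a position given by the
  shape. With \<open>c = 1\<close> and shifted shapes the position is the row length, with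
  \<open>c = m\<close> and ordinary shapes it is the part plus m - i. \<open>r\<close> counts rows
  from 1, the matrix from 0.\<close>

definition series_mat :: "(nat \<Rightarrow> 'a::comm_ring_1 fps) \<Rightarrow> nat \<Rightarrow> nat \<Rightarrow> (nat \<Rightarrow> nat) \<Rightarrow> 'a mat" where
  "series_mat g c m r = mat m m (\<lambda>(i, j). fps_nth (g j) (r (Suc i) + c - Suc i))"

lemma series_mat_carrier [simp]: "series_mat g c m r \<in> carrier_mat m m"
  by (simp add: series_mat_def)

text \<open>Multilinearity in the rows: in the Leibniz formula, the product over rows of sums
  becomes a sum over choice functions, and the signed sum over permutations moves inside.\<close>

lemma det_expand_rows:
  fixes A :: "'a::comm_ring_1 mat"
  assumes A: "A \<in> carrier_mat m m"
    and fin: "\<And>i. i \<in> {1..m} \<Longrightarrow> finite (R i)"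
    and rows: "\<And>i j. i < m \<Longrightarrow> j < m \<Longrightarrow>
      A $$ (i, j) = (\<Sum>t\<in>R (Suc i). w (Suc i) t * fps_nth (g j) (t + c - Suc i))"
  shows "det A = (\<Sum>r\<in>PiE {1..m} R. (\<Prod>i=1..m. w i (r i)) * det (series_mat g c m r))"
proof -
  have "(\<Prod>i = 0..<m. A $$ (i, p i)) =
      (\<Sum>r\<in>PiE {1..m} R. (\<Prod>i=1..m. w i (r i)) * (\<Prod>i=0..<m. series_mat g c m r $$ (i, p i)))"
    if p: "p permutes {0..<m}" for p
  proof -
    have lt: "p i < m" if "i < m" for i
      using permutes_in_image[OF p, of i] that by simp
    have "(\<Prod>i = 0..<m. A $$ (i, p i)) =
        (\<Prod>i = 0..<m. \<Sum>t\<in>R (Suc i). w (Suc i) t * fps_nth (g (p i)) (t + c - Suc i))"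
      by (intro prod.cong) (auto simp: rows lt)
    also have "\<dots> = (\<Prod>i=1..m. \<Sum>t\<in>R i. w i t * fps_nth (g (p (i - 1))) (t + c - i))"
      by (simp add: prod.atLeast1_atMost_eq atLeast0LessThan)
    also have "\<dots> = (\<Sum>r\<in>PiE {1..m} R. \<Prod>i=1..m. w i (r i) * fps_nth (g (p (i - 1))) (r i + c - i))"
      by (rule prod_sum_PiE) (use fin in auto)
    also have "\<dots> = (\<Sum>r\<in>PiE {1..m} R. (\<Prod>i=1..m. w i (r i)) *
        (\<Prod>i=0..<m. series_mat g c m r $$ (i, p i)))"
    proof (intro sum.cong refl)
      fix r
      have "(\<Prod>i=1..m. fps_nth (g (p (i - 1))) (r i + c - i)) =
          (\<Prod>i=0..<m. series_mat g c m r $$ (i, p i))"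
        by (simp add: prod.atLeast1_atMost_eq atLeast0LessThan series_mat_def lt)
      then show "(\<Prod>i=1..m. w i (r i) * fps_nth (g (p (i - 1))) (r i + c - i)) =
          (\<Prod>i=1..m. w i (r i)) * (\<Prod>i=0..<m. series_mat g c m r $$ (i, p i))"
        by (simp add: prod.distrib)
    qed
    finally show ?thesis .
  qed
  then have "det A = (\<Sum>p | p permutes {0..<m}. \<Sum>r\<in>PiE {1..m} R.
      signof p * ((\<Prod>i=1..m. w i (r i)) * (\<Prod>i=0..<m. series_mat g c m r $$ (i, p i))))"
    by (subst det_def'[OF A]) (auto intro!: sum.cong simp: sum_distrib_left)
  also have "\<dots> = (\<Sum>r\<in>PiE {1..m} R. (\<Prod>i=1..m. w i (r i)) * det (series_mat g c m r))"
    by (subst sum.swap) (auto intro!: sum.cong simp: det_def'[OF series_mat_carrier] sum_distrib_left mult_ac)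
  finally show ?thesis .
qed

section \<open>Determinant steps for a single letter\<close>

text \<open>Telescoping, since the coefficient of \<open>g\<close> at n is that of \<open>G\<close>
  at n minus \<open>x\<close> times that at n - 1. The conditional covers the coefficient at -1,
  which truncated subtraction would misread as the one at 0.\<close>

lemma fps_geometric_partial_sum:
  fixes x :: "'a::comm_ring_1"
  assumes G: "G * (1 - fps_const x * fps_X) = g" and "a \<le> b" "i \<le> a + c"
  shows "(\<Sum>t=a..b. x ^ (b - t) * fps_nth g (t + c - i)) =
    fps_nth G (b + c - i) - (if a + c = i then 0 else x ^ (Suc b - a) * fps_nth G (a + c - Suc i))"
proof -
  have gn: "fps_nth g n = fps_nth G n - (if n = 0 then 0 else x * fps_nth G (n - 1))" for n
    unfolding G[symmetric] by (simp add: algebra_simps)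
  show ?thesis
    using \<open>a \<le> b\<close>
  proof (induction b rule: dec_induct)
    case base
    then show ?case using assms(3) by (simp add: gn)
  next
    case (step b)
    have "(\<Sum>t=a..Suc b. x ^ (Suc b - t) * fps_nth g (t + c - i)) =
        x * (\<Sum>t=a..b. x ^ (b - t) * fps_nth g (t + c - i)) + fps_nth g (Suc b + c - i)"
      using step.hyps by (simp add: sum_distrib_left Suc_diff_le mult_ac)
    also have "\<dots> = fps_nth G (Suc b + c - i) -
        (if a + c = i then 0 else x ^ (Suc (Suc b) - a) * fps_nth G (a + c - Suc i))"
    proof -
      have e: "Suc b + c - i = Suc (b + c - i)"
        using step.hyps assms(3) by auto
      show ?thesis
        unfolding step.IH e using step.hyps
        by (simp add: gn[of "Suc (b + c - i)"] algebra_simps Suc_diff_le)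
    qed
    finally show ?case .
  qed
qed

text \<open>Subtracting from each row a multiple of the next one cuts the geometric series off just
  before the next position, which leaves exactly the horizontal strips.\<close>

lemma det_geometric_step:
  fixes x :: "'a::comm_ring_1"
  assumes G: "\<And>j. j < m \<Longrightarrow> G j * (1 - fps_const x * fps_X) = g j"
    and r: "\<And>i. 1 \<le> i \<Longrightarrow> i < m \<Longrightarrow> r (Suc i) \<le> r i"
    and o: "0 < m \<Longrightarrow> o' \<le> r m" "0 < m \<Longrightarrow> o' + c = m"
  shows "det (series_mat G c m r) =
    (\<Sum>r'\<in>PiE {1..m} (\<lambda>i. {(if i < m then r (Suc i) else o')..r i}).
      (\<Prod>i=1..m. x ^ (r i - r' i)) * det (series_mat g c m r'))"
proof -
  let ?lo = "\<lambda>i. if i < m then r (Suc i) else o'"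
  \<comment> \<open>The exponent counts the columns from \<open>r (Suc (Suc i))\<close> to
    \<open>r (Suc i)\<close>, so that the multiple of the next row is the lower end of the
    telescoping sum.\<close>
  define U :: "'a mat" where "U = mat m m (\<lambda>(i, k). if k = i then 1 else
    if k = Suc i then - (x ^ (Suc (r (Suc i)) - r (Suc (Suc i)))) else 0)"
  let ?D = "series_mat G c m r"
  have U: "U \<in> carrier_mat m m" by (simp add: U_def)
  have "upper_triangular U" by (auto simp: U_def)
  then have "det U = prod_list (diag_mat U)"
    by (rule det_upper_triangular[OF _ U])
  also have "diag_mat U = map (\<lambda>i. 1) [0..<m]"
    by (auto simp: diag_mat_def U_def)
  finally have detU: "det U = 1" by (simp add: map_replicate_const)
  have rm: "o' \<le> r i" if "1 \<le> i" "i \<le> m" for i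
    using that(2)
  proof (induction i rule: inc_induct)
    case base then show ?case using o that by simp
  next
    case (step k)
    then show ?case using r[of k] that by simp
  qed
  have "(U * ?D) $$ (i, j) = (\<Sum>t\<in>{?lo (Suc i)..r (Suc i)}.
      x ^ (r (Suc i) - t) * fps_nth (g j) (t + c - Suc i))" if i: "i < m" and j: "j < m" for i j
  proof -
    have "(U * ?D) $$ (i, j) = (\<Sum>k<m. U $$ (i, k) * ?D $$ (k, j))"
      using i j by (simp add: U_def series_mat_def scalar_prod_def atLeast0LessThan)
    also have "\<dots> = (\<Sum>k<m. (if k = i then ?D $$ (i, j) else 0) +
       (if k = Suc i then - (x ^ (Suc (r (Suc i)) - r (Suc (Suc i)))) * ?D $$ (Suc i, j) else 0))"
      using i by (intro sum.cong) (auto simp: U_def)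
    also have "\<dots> = ?D $$ (i, j) - (if Suc i < m then
        x ^ (Suc (r (Suc i)) - r (Suc (Suc i))) * ?D $$ (Suc i, j) else 0)"
      using i by (simp add: sum.distrib)
    \<comment> \<open>The last row has no successor. There \<open>o' + c = m\<close> puts the lower
      end at position 0, where the formula subtracts nothing.\<close>
    also have "\<dots> = fps_nth (G j) (r (Suc i) + c - Suc i) - (if ?lo (Suc i) + c = Suc i then 0 else
        x ^ (Suc (r (Suc i)) - ?lo (Suc i)) * fps_nth (G j) (?lo (Suc i) + c - Suc (Suc i)))"
      using i j o rm[of "Suc (Suc i)"] by (auto simp: series_mat_def) 
    also have "\<dots> = (\<Sum>t\<in>{?lo (Suc i)..r (Suc i)}.
      x ^ (r (Suc i) - t) * fps_nth (g j) (t + c - Suc i))"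
      using i j o rm[of "Suc (Suc i)"] r[of "Suc i"] rm[of "Suc i"]
      by (intro fps_geometric_partial_sum[symmetric] G) (auto split: if_splits)
    finally show ?thesis .
  qed
  then have "det (U * ?D) = (\<Sum>r'\<in>PiE {1..m} (\<lambda>i. {?lo i..r i}).
      (\<Prod>i=1..m. x ^ (r i - r' i)) * det (series_mat g c m r'))"
    by (intro det_expand_rows) (use U in auto)
  moreover have "det (U * ?D) = det ?D"
    using det_mult[OF U series_mat_carrier] detU by simp
  ultimately show ?thesis by simp
qed

text \<open>A factor 1 + yq lets each row keep its end or lose one box. Independent choices can
  break monotonicity only by one; then two adjacent matrix rows agree and the term vanishes.\<close>

lemma det_linear_step:
  fixes y :: "'a::comm_ring_1"
  assumes G: "\<And>j. j < m \<Longrightarrow> G j = g j * (1 + fps_const y * fps_X)"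
    and r: "\<And>i. 1 \<le> i \<Longrightarrow> i < m \<Longrightarrow> r (Suc i) \<le> r i"
    and lo: "\<And>i. 1 \<le> i \<Longrightarrow> i \<le> m \<Longrightarrow> i \<le> Suc (r i)"
  shows "det (series_mat G 1 m r) =
    (\<Sum>r'\<in>{r' \<in> PiE {1..m} (\<lambda>i. {max (i - 1) (r i - 1)..r i}).
        \<forall>i. 1 \<le> i \<longrightarrow> i < m \<longrightarrow> r' (Suc i) \<le> r' i}.
      (\<Prod>i=1..m. y ^ (r i - r' i)) * det (series_mat g 1 m r'))"
proof -
  let ?R = "\<lambda>i. {max (i - 1) (r i - 1)..r i}"
  have "series_mat G 1 m r $$ (i, j) =
      (\<Sum>t\<in>?R (Suc i). y ^ (r (Suc i) - t) * fps_nth (g j) (t + 1 - Suc i))"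
    if i: "i < m" and j: "j < m" for i j
  \<comment> \<open>In this case the position is 0: only the constant coefficient is read and no box
    can be lost, hence the lower bound \<open>i - 1\<close> in the statement.\<close>
  proof (cases "r (Suc i) = i")
    case True
    then show ?thesis using i j by (simp add: series_mat_def G algebra_simps)
  next
    case False
    then have gt: "i < r (Suc i)" using lo[of "Suc i"] i by simp
    then have R: "?R (Suc i) = {r (Suc i) - 1, r (Suc i)}" by auto
    from gt obtain d where d: "r (Suc i) = Suc (i + d)" using less_imp_Suc_add by blast
    show ?thesis unfolding R using i j
      by (simp add: series_mat_def G d algebra_simps)
  qed
  then have "det (series_mat G 1 m r) =
    (\<Sum>r'\<in>PiE {1..m} ?R. (\<Prod>i=1..m. y ^ (r i - r' i)) * det (series_mat g 1 m r'))"
    by (intro det_expand_rows) auto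
  also have "\<dots> = (\<Sum>r'\<in>{r' \<in> PiE {1..m} ?R.
        \<forall>i. 1 \<le> i \<longrightarrow> i < m \<longrightarrow> r' (Suc i) \<le> r' i}.
      (\<Prod>i=1..m. y ^ (r i - r' i)) * det (series_mat g 1 m r'))"
  proof (intro sum.mono_neutral_right ballI)
    show "finite (PiE {1..m} ?R)" by (intro finite_PiE) auto
    fix r' assume "r' \<in> PiE {1..m} ?R -
      {r' \<in> PiE {1..m} ?R. \<forall>i. 1 \<le> i \<longrightarrow> i < m \<longrightarrow> r' (Suc i) \<le> r' i}"
    then obtain i where r': "r' \<in> PiE {1..m} ?R" and i: "1 \<le> i" "i < m" "r' i < r' (Suc i)"
      by fastforce
    have "r' i \<in> ?R i" "r' (Suc i) \<in> ?R (Suc i)"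
      using i PiE_mem[OF r', of i] PiE_mem[OF r', of "Suc i"] by auto
    \<comment> \<open>By \<open>r' (Suc i) \<le> r (Suc i) \<le> r i \<le> Suc (r' i)\<close>. The
      two rows are thus read at the same position.\<close>
    then have e: "r' (Suc i) = Suc (r' i)" using i r[of i] by auto
    then have "row (series_mat g 1 m r') (i - 1) = row (series_mat g 1 m r') i"
      using i by (intro eq_vecI) (auto simp: series_mat_def)
    then have "det (series_mat g 1 m r') = 0"
      using i by (intro det_identical_rows[OF series_mat_carrier, of "i - 1" i]) auto
    then show "(\<Prod>i=1..m. y ^ (r i - r' i)) * det (series_mat g 1 m r') = 0" by simp
  qed auto
  finally show ?thesis .
qed

text \<open>Laplace expansion along a last column with at most one nonzero entry. It removes the row
  and column that a new index adds.\<close>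

lemma det_last_column_unit:
  fixes A :: "'a::comm_ring_1 mat"
  assumes A: "A \<in> carrier_mat (Suc m) (Suc m)" and B: "B \<in> carrier_mat m m"
    and last: "\<And>i. i < m \<Longrightarrow> A $$ (i, m) = 0"
    and sub: "\<And>i j. i < m \<Longrightarrow> j < m \<Longrightarrow> A $$ (i, j) = B $$ (i, j)"
  shows "det A = A $$ (m, m) * det B"
proof -
  have "det A = (\<Sum>i<Suc m. A $$ (i, m) * cofactor A i m)"
    by (rule laplace_expansion_column[OF A]) simp
  also have "\<dots> = A $$ (m, m) * cofactor A m m" by (simp add: last)
  also have "cofactor A m m = det (mat_delete A m m)"
    by (simp add: cofactor_def flip: mult_2 power_mult)
  also have "mat_delete A m m = B"
    by (rule eq_matI) (use A B sub in \<open>auto simp: mat_delete_def\<close>)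
  finally show ?thesis .
qed

section \<open>Division of palindromic polynomials by quadratic factors\<close>

text \<open>In terms of w = q + 1/q, where q is the formal variable, these are the products of q ^ m with
  a polynomial in w of degree at most m.\<close>

primrec homog :: "nat \<Rightarrow> 'a::comm_ring_1 fps \<Rightarrow> bool" where
  "homog 0 Q \<longleftrightarrow> (\<exists>d. Q = fps_const d)"
| "homog (Suc m) Q \<longleftrightarrow>
    (\<exists>Q1 Q2. homog m Q1 \<and> homog m Q2 \<and> Q = fps_X * Q1 + (1 + fps_X ^ 2) * Q2)"

lemma homog_SucI:
  "homog m Q1 \<Longrightarrow> homog m Q2 \<Longrightarrow> Q = fps_X * Q1 + (1 + fps_X ^ 2) * Q2 \<Longrightarrow> homog (Suc m) Q"
  by auto

lemma homog_const_mult: "homog m Q \<Longrightarrow> homog m (fps_const d * Q)"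
proof (induction m arbitrary: Q)
  case 0 then show ?case by auto
next
  case (Suc m)
  then obtain Q1 Q2 where "homog m Q1" "homog m Q2" "Q = fps_X * Q1 + (1 + fps_X ^ 2) * Q2" by auto
  with Suc.IH show ?case
    by (intro homog_SucI[of m "fps_const d * Q1" "fps_const d * Q2"]) (auto simp: algebra_simps)
qed

lemma homog_add: "homog m P \<Longrightarrow> homog m Q \<Longrightarrow> homog m (P + Q)"
proof (induction m arbitrary: P Q)
  case 0 then show ?case by (auto intro: fps_const_add)
next
  case (Suc m)
  from Suc.prems obtain P1 P2 Q1 Q2 where
    "homog m P1" "homog m P2" "P = fps_X * P1 + (1 + fps_X ^ 2) * P2"
    "homog m Q1" "homog m Q2" "Q = fps_X * Q1 + (1 + fps_X ^ 2) * Q2" by auto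
  with Suc.IH show ?case
    by (intro homog_SucI[of m "P1 + Q1" "P2 + Q2"]) (auto simp: algebra_simps)
qed

lemma homog_X_power: "homog m (fps_X ^ m)"
proof (induction m)
  case 0 show ?case by (auto intro!: exI[of _ 1])
next
  case (Suc m)
  have "homog m (0 :: 'a fps)" using homog_const_mult[OF Suc, of 0] by simp
  with Suc show ?case by (intro homog_SucI[of m "fps_X ^ m" 0]) auto
qed

lemma homog_quadratic_mult:
  "homog m Q \<Longrightarrow> homog (Suc m) ((1 + fps_const d * fps_X + fps_X ^ 2) * Q)"
  by (intro homog_SucI[of m "fps_const d * Q" Q] homog_const_mult) (auto simp: algebra_simps)

text \<open>Division with remainder by w - a, because 1 - aq + q^2 is q (w - a). The remainder is a
  constant, times the power of q that keeps the degree.\<close>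

lemma homog_divide:
  assumes "homog (Suc m) Q"
  shows "\<exists>c Q'. homog m Q' \<and>
    Q = fps_const c * fps_X ^ Suc m + (1 - fps_const a * fps_X + fps_X ^ 2) * Q'"
  using assms
proof (induction m arbitrary: Q)
  case 0
  then obtain d1 d2 where "Q = fps_X * fps_const d1 + (1 + fps_X ^ 2) * fps_const d2" by auto
  then have "Q = fps_const (d1 + a * d2) * fps_X ^ Suc 0 +
      (1 - fps_const a * fps_X + fps_X ^ 2) * fps_const d2"
    by (simp add: algebra_simps flip: fps_const_add fps_const_mult)
  then show ?case by (intro exI[of _ "d1 + a * d2"] exI[of _ "fps_const d2"]) auto
next
  case (Suc m)
  then obtain Q1 Q2 where Q: "homog (Suc m) Q1" "homog (Suc m) Q2"
    "Q = fps_X * Q1 + (1 + fps_X ^ 2) * Q2"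
    using homog.simps(2)[of "Suc m" Q] by blast
  then have "homog (Suc m) (Q1 + fps_const a * Q2)" by (intro homog_add homog_const_mult)
  then obtain c Q' where Q': "homog m Q'" "Q1 + fps_const a * Q2 = fps_const c * fps_X ^ Suc m +
      (1 - fps_const a * fps_X + fps_X ^ 2) * Q'" using Suc.IH by blast
  have "homog m (0 :: 'a fps)" using homog_const_mult[OF Q'(1), of 0] by simp
  then have "homog (Suc m) (fps_X * Q')" using Q'(1) by (intro homog_SucI[of m Q' 0]) auto
  then have "homog (Suc m) (fps_X * Q' + Q2)" using Q by (intro homog_add)
  \<comment> \<open>Here w is replaced by a: 1 + q^2 is aq plus the divisor.\<close>
  moreover have "Q = fps_X * (Q1 + fps_const a * Q2) + (1 - fps_const a * fps_X + fps_X ^ 2) * Q2"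
    by (simp add: Q(3) algebra_simps)
  then have "Q = fps_const c * fps_X ^ Suc (Suc m) +
      (1 - fps_const a * fps_X + fps_X ^ 2) * (fps_X * Q' + Q2)"
    unfolding Q'(2) by (simp add: algebra_simps)
  ultimately show ?case by blast
qed

text \<open>The remainder theorem: the factors are q (w + d k), and their values at w = a give the
  remainder. The quotient has degree one less, so it is 0 for empty \<open>K\<close>.\<close>

lemma quadratic_prod_divide:
  fixes d :: "nat \<Rightarrow> 'a::comm_ring_1"
  assumes "finite K"
  shows "\<exists>Q. (card K = 0 \<longrightarrow> Q = 0) \<and> (0 < card K \<longrightarrow> homog (card K - 1) Q) \<and>
    (\<Prod>k\<in>K. 1 + fps_const (d k) * fps_X + fps_X ^ 2) =
      fps_const (\<Prod>k\<in>K. a + d k) * fps_X ^ card K + (1 - fps_const a * fps_X + fps_X ^ 2) * Q"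
  using assms
proof (induction K rule: finite_induct)
  case empty show ?case by (intro exI[of _ 0]) simp
next
  case (insert k K)
  let ?A = "\<lambda>k. 1 + fps_const (d k) * fps_X + fps_X ^ 2 :: 'a fps"
  let ?B = "1 - fps_const a * fps_X + fps_X ^ 2 :: 'a fps"
  let ?c = "\<Prod>k\<in>K. a + d k"
  obtain Q where Q: "card K = 0 \<longrightarrow> Q = 0" "0 < card K \<longrightarrow> homog (card K - 1) Q"
    "prod ?A K = fps_const ?c * fps_X ^ card K + ?B * Q" using insert.IH by (elim exE conjE)
  \<comment> \<open>Comes from multiplying the division for \<open>K\<close> by the new factor,
    written as (a + d k) q plus the divisor.\<close>
  define Q' where "Q' = fps_const ?c * fps_X ^ card K + ?A k * Q"
  have "homog (card K) (?A k * Q)"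
  proof (cases "card K")
    case 0
    then show ?thesis using Q by simp
  next
    case (Suc m)
    then show ?thesis using homog_quadratic_mult[of m Q "d k"] Q(2) by (simp del: homog.simps)
  qed
  then have "homog (card K) Q'"
    unfolding Q'_def by (intro homog_add homog_const_mult homog_X_power)
  moreover have "?A k * prod ?A K = fps_const (a + d k) * fps_const ?c * fps_X ^ Suc (card K) + ?B * Q'"
    unfolding Q(3) Q'_def by (simp add: algebra_simps flip: fps_const_add)
  ultimately show ?case using insert.hyps
    by (intro exI[of _ Q']) simp
qed

text \<open>Repeated division, as in Newton interpolation: the remainder at factor
  \<open>Suc j\<close> is the coefficient of column \<open>j\<close>, and the quotient is passed on
  to the remaining factors. The last quotient is the constant \<open>d\<close>.\<close>

lemma homog_expand:
  fixes a :: "nat \<Rightarrow> 'a::field"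
  assumes "j \<le> n" "homog (n - j) Q"
  shows "\<exists>cf d. Q * (\<Prod>k\<in>{j<..n}. inverse (1 - fps_const (a k) * fps_X + fps_X ^ 2)) =
    fps_const d + (\<Sum>l\<in>{j..<n}. fps_const (cf l) *
      (fps_X ^ (n - l) * (\<Prod>k\<in>{l<..n}. inverse (1 - fps_const (a k) * fps_X + fps_X ^ 2))))"
  using assms
proof (induction j arbitrary: Q rule: inc_induct)
  case base
  then show ?case by auto
next
  case (step j)
  let ?B = "\<lambda>k. 1 - fps_const (a k) * fps_X + fps_X ^ 2 :: 'a fps"
  let ?P = "\<lambda>l. \<Prod>k\<in>{l<..n}. inverse (?B k)"
  have "homog (Suc (n - Suc j)) Q" using step by (simp add: Suc_diff_Suc del: homog.simps)
  from homog_divide[OF this, of "a (Suc j)"] obtain c Q' where Q': "homog (n - Suc j) Q'"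
    "Q = fps_const c * fps_X ^ Suc (n - Suc j) + ?B (Suc j) * Q'" by blast
  from step.IH[OF Q'(1)] obtain cf e where cf: "Q' * ?P (Suc j) =
    fps_const e + (\<Sum>l\<in>{Suc j..<n}. fps_const (cf l) * (fps_X ^ (n - l) * ?P l))" by blast
  have "{j<..n} = insert (Suc j) {Suc j<..n}" using step by auto
  then have P: "?P j = inverse (?B (Suc j)) * ?P (Suc j)" by simp
  have "inverse (?B (Suc j)) * ?B (Suc j) = 1" by (intro inverse_mult_eq_1) simp
  moreover have "?B (Suc j) * Q' * ?P j = (inverse (?B (Suc j)) * ?B (Suc j)) * (Q' * ?P (Suc j))"
    unfolding P by (simp only: mult_ac)
  ultimately have BQ: "?B (Suc j) * Q' * ?P j = Q' * ?P (Suc j)" by (simp only: mult_1)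
  have "Q * ?P j = fps_const c * (fps_X ^ (n - j) * ?P j) + ?B (Suc j) * Q' * ?P j"
    using step.hyps unfolding Q'(2) by (simp only: Suc_diff_Suc distrib_right mult.assoc)
  then have "Q * ?P j = fps_const e + (\<Sum>l\<in>{Suc j..<n}. fps_const (cf l) * (fps_X ^ (n - l) * ?P l))
      + fps_const c * (fps_X ^ (n - j) * ?P j)"
    unfolding BQ cf by (simp only: add_ac)
  also have "\<dots> = fps_const e + (\<Sum>l\<in>{j..<n}. fps_const ((cf(j := c)) l) * (fps_X ^ (n - l) * ?P l))"
    using step.hyps by (simp add: sum.atLeast_Suc_lessThan[of j n])
  finally show ?case by blast
qed

text \<open>Writing A and B for the two kinds of quadratic factors, A - B is a multiple of the variable.
  Hence the columns on the left are a triangular combination of those on the right, up to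
  constants, which are invisible at positive positions.\<close>

lemma det_quadratic_ratio:
  fixes X Y :: "nat \<Rightarrow> 'a::field" and p :: "nat \<Rightarrow> nat"
  assumes p: "\<And>i. i < n \<Longrightarrow> 0 < p i"
  shows "det (mat n n (\<lambda>(i, j). fps_nth (\<Prod>k\<in>{j<..n}. (1 + fps_const (Y k) * fps_X + fps_X ^ 2) *
        inverse (1 - fps_const (X k) * fps_X + fps_X ^ 2)) (p i))) =
    (\<Prod>j<n. \<Prod>k\<in>{j<..n}. X (Suc j) + Y k) *
    det (mat n n (\<lambda>(i, j). fps_nth (fps_X ^ (n - j) * (\<Prod>k\<in>{j<..n}.
        inverse (1 - fps_const (X k) * fps_X + fps_X ^ 2))) (p i)))"
proof -
  let ?A = "\<lambda>k. 1 + fps_const (Y k) * fps_X + fps_X ^ 2 :: 'a fps"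
  let ?B = "\<lambda>k. 1 - fps_const (X k) * fps_X + fps_X ^ 2 :: 'a fps"
  let ?P = "\<lambda>j. \<Prod>k\<in>{j<..n}. inverse (?B k)"
  let ?h = "\<lambda>j. fps_X ^ (n - j) * ?P j"
  let ?g = "\<lambda>j. \<Prod>k\<in>{j<..n}. ?A k * inverse (?B k)"
  let ?c = "\<lambda>j. \<Prod>k\<in>{j<..n}. X (Suc j) + Y k"
  have "\<exists>cf d. cf j = ?c j \<and> (\<forall>l<j. cf l = 0) \<and>
    ?g j = fps_const d + (\<Sum>l<n. fps_const (cf l) * ?h l)" if j: "j < n" for j
  proof -
    \<comment> \<open>Dividing by \<open>?B (Suc j)\<close> first makes the diagonal coefficient
      \<open>?c j\<close> explicit; the quotient only involves later columns.\<close>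
    from quadratic_prod_divide[of "{j<..n}" Y "X (Suc j)"] j obtain Q where
      Q: "homog (n - Suc j) Q" "prod ?A {j<..n} = fps_const (?c j) * fps_X ^ (n - j) + ?B (Suc j) * Q"
      by auto
    from homog_expand[OF _ Q(1), of X] j obtain cf d where
      cf: "Q * ?P (Suc j) = fps_const d + (\<Sum>l\<in>{Suc j..<n}. fps_const (cf l) * ?h l)" by auto
    have "{j<..n} = insert (Suc j) {Suc j<..n}" using j by auto
    then have P: "?P j = inverse (?B (Suc j)) * ?P (Suc j)" by simp
    have "inverse (?B (Suc j)) * ?B (Suc j) = 1" by (intro inverse_mult_eq_1) simp
    moreover have "?B (Suc j) * Q * ?P j = (inverse (?B (Suc j)) * ?B (Suc j)) * (Q * ?P (Suc j))"
      unfolding P by (simp only: mult_ac)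
    ultimately have BQ: "?B (Suc j) * Q * ?P j = Q * ?P (Suc j)" by (simp only: mult_1)
    have "?g j = fps_const (?c j) * ?h j + ?B (Suc j) * Q * ?P j"
      unfolding prod.distrib Q(2) by (simp only: distrib_right mult.assoc)
    then have "?g j = fps_const d + (\<Sum>l\<in>{Suc j..<n}. fps_const (cf l) * ?h l) + fps_const (?c j) * ?h j"
      unfolding BQ cf by (simp only: add_ac)
    also have "\<dots> = fps_const d + (\<Sum>l\<in>{j..<n}. fps_const ((cf(j := ?c j)) l) * ?h l)"
      using j by (simp add: sum.atLeast_Suc_lessThan[of j n])
    also have "(\<Sum>l\<in>{j..<n}. fps_const ((cf(j := ?c j)) l) * ?h l) =
        (\<Sum>l<n. fps_const (if l < j then 0 else (cf(j := ?c j)) l) * ?h l)"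
      by (intro sum.mono_neutral_cong_left) auto
    finally show ?thesis
      by (intro exI[of _ "\<lambda>l. if l < j then 0 else (cf(j := ?c j)) l"] exI[of _ d]) auto
  qed
  then have "\<forall>j. \<exists>e. j < n \<longrightarrow> fst e j = ?c j \<and> (\<forall>l<j. fst e l = 0) \<and>
    ?g j = fps_const (snd e) + (\<Sum>l<n. fps_const (fst e l) * ?h l)"
    unfolding ex_simps(6) split_paired_Ex fst_conv snd_conv by (intro allI impI)
  then obtain e where e: "\<forall>j. j < n \<longrightarrow> fst (e j) j = ?c j \<and> (\<forall>l<j. fst (e j) l = 0) \<and>
    ?g j = fps_const (snd (e j)) + (\<Sum>l<n. fps_const (fst (e j) l) * ?h l)"
    by (elim exE[OF choice])
  define cf where "cf j = fst (e j)" for j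
  have cf: "cf j j = ?c j" "\<And>l. l < j \<Longrightarrow> cf j l = 0"
    "?g j = fps_const (snd (e j)) + (\<Sum>l<n. fps_const (cf j l) * ?h l)" if "j < n" for j
    using e[rule_format, OF that] unfolding cf_def by (elim conjE; simp only:; fail)+
  define C where "C = mat n n (\<lambda>(l, j). cf j l)"
  define H where "H = mat n n (\<lambda>(i, j). fps_nth (?h j) (p i))"
  have C: "C \<in> carrier_mat n n" and H: "H \<in> carrier_mat n n" by (simp_all add: C_def H_def)
  have "det C = prod_list (diag_mat C)"
    by (rule det_lower_triangular[OF _ C]) (simp add: C_def cf)
  also have "diag_mat C = map ?c [0..<n]" by (auto simp: diag_mat_def C_def cf)
  also have "prod_list \<dots> = (\<Prod>j<n. ?c j)" by (simp add: prod.list_conv_set_nth atLeast0LessThan)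
  finally have detC: "det C = (\<Prod>j<n. ?c j)" .
  have "mat n n (\<lambda>(i, j). fps_nth (?g j) (p i)) = H * C"
  proof (rule eq_matI)
    fix i j assume "i < dim_row (H * C)" "j < dim_col (H * C)"
    then have ij: "i < n" "j < n" by (simp_all add: H_def C_def)
    \<comment> \<open>All positions are positive, so the constant \<open>snd (e j)\<close>
      contributes nothing.\<close>
    have "fps_nth (?g j) (p i) = (\<Sum>l<n. cf j l * fps_nth (?h l) (p i))"
      unfolding cf(3)[OF ij(2)] using p[OF ij(1)]
      by (simp only: fps_add_nth fps_sum_nth fps_mult_left_const_nth fps_nth_fps_const) simp
    also have "\<dots> = (H * C) $$ (i, j)"
      using ij by (simp add: H_def C_def scalar_prod_def atLeast0LessThan mult.commute)
    finally show "mat n n (\<lambda>(i, j). fps_nth (?g j) (p i)) $$ (i, j) = (H * C) $$ (i, j)"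
      using ij by simp
  qed (simp_all add: H_def C_def)
  then show ?thesis using det_mult[OF H C] detC by (simp add: H_def mult.commute)
qed

section \<open>Peeling off the largest letter\<close>

text \<open>Shapes are recorded by the columns r i in which their rows end. In these coordinates both
  ordinary and shifted shapes are the weakly decreasing r; they differ only in the columns
  (off i) + 1 in which the rows start.\<close>

definition row_diagram :: "(nat \<Rightarrow> nat) \<Rightarrow> nat \<Rightarrow> (nat \<Rightarrow> nat) \<Rightarrow> (nat \<times> nat) set" where
  "row_diagram off m r = (SIGMA i:{1..m}. {off i<..r i})"

definition row_shape :: "(nat \<Rightarrow> nat) \<Rightarrow> nat \<Rightarrow> (nat \<Rightarrow> nat) \<Rightarrow> bool" where
  "row_shape off m r \<longleftrightarrow> (\<forall>i\<in>{1..m}. off i \<le> r i) \<and> (\<forall>i. 1 \<le> i \<longrightarrow> i < m \<longrightarrow> r (Suc i) \<le> r i)"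

text \<open>The rank bound \<open>a\<close> is exclusive, so passing to \<open>Suc a\<close> admits
  exactly one more letter. \<open>Adm\<close> holds the conditions on single boxes, in which the two
  families of tableaux differ.\<close>

definition tableaux :: "(nat \<Rightarrow> nat) \<Rightarrow> nat \<Rightarrow> (nat \<times> nat \<Rightarrow> letter \<Rightarrow> bool) \<Rightarrow> nat \<Rightarrow> (nat \<Rightarrow> nat) \<Rightarrow> filling set" where
  "tableaux off m Adm a r = {F. dom F = row_diagram off m r \<and>
     (\<forall>b x. F b = Some x \<longrightarrow> Adm b x \<and> letter_rank x < a) \<and>
     rows_weakly_increase F \<and> columns_weakly_increase F \<and>
     no_unprimed_twice_in_column F \<and> no_primed_twice_in_row F}"

definition weight :: "(letter \<Rightarrow> 'a::comm_ring_1) \<Rightarrow> filling \<Rightarrow> 'a" where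
  "weight z F = (\<Prod>b\<in>dom F. z (the (F b)))"

definition tableau_sum where
  "tableau_sum z off m Adm a r = (\<Sum>F\<in>tableaux off m Adm a r. weight z F)"

text \<open>The shapes that may remain when all \<open>e\<close> are removed: a horizontal strip
  goes if \<open>e\<close> is unprimed, a vertical one if it is primed. \<open>PiE\<close> makes
  each shape a unique function.\<close>

definition strips :: "(nat \<Rightarrow> nat) \<Rightarrow> nat \<Rightarrow> (nat \<times> nat \<Rightarrow> letter \<Rightarrow> bool) \<Rightarrow> letter \<Rightarrow> (nat \<Rightarrow> nat) \<Rightarrow> (nat \<Rightarrow> nat) set" where
  "strips off m Adm e r = {r' \<in> PiE {1..m} (\<lambda>i. {off i..r i}).
     (\<forall>i. 1 \<le> i \<longrightarrow> i < m \<longrightarrow> r' (Suc i) \<le> r' i) \<and>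
     (if primed e then \<forall>i\<in>{1..m}. r i \<le> Suc (r' i)
      else \<forall>i. 1 \<le> i \<longrightarrow> i < m \<longrightarrow> r (Suc i) \<le> r' i) \<and>
     (\<forall>i\<in>{1..m}. \<forall>j\<in>{r' i<..r i}. Adm (i, j) e)}"

definition below :: "nat \<Rightarrow> filling \<Rightarrow> (nat \<times> nat) set" where
  "below a F = {b. \<exists>x. F b = Some x \<and> letter_rank x < a}"

text \<open>Counting avoids the maximum of a possibly empty set. The result is the last column of
  the smaller letters because these fill an initial segment of the row.\<close>

definition row_cut :: "(nat \<Rightarrow> nat) \<Rightarrow> nat \<Rightarrow> nat \<Rightarrow> filling \<Rightarrow> nat \<Rightarrow> nat" where
  "row_cut off m a F = (\<lambda>i\<in>{1..m}. off i + card {j. (i, j) \<in> below a F})"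

definition fill_strip :: "(nat \<times> nat) set \<Rightarrow> letter \<Rightarrow> filling \<Rightarrow> filling" where
  "fill_strip B e F = (\<lambda>b. if b \<in> dom F then F b else if b \<in> B then Some e else None)"

lemma mem_row_diagram [simp]:
  "(i, j) \<in> row_diagram off m r \<longleftrightarrow> 1 \<le> i \<and> i \<le> m \<and> off i < j \<and> j \<le> r i"
  by (auto simp: row_diagram_def)

lemma finite_row_diagram [simp]: "finite (row_diagram off m r)"
  by (auto simp: row_diagram_def)

lemma finite_tableaux [simp]: "finite (tableaux off m Adm a r)"
proof (rule finite_subset)
  let ?L = "{x. letter_rank x < a}"
  have "inj_on letter_rank ?L" by (auto simp: inj_on_def letter_rank_inject)
  moreover have "finite (letter_rank ` ?L)" by (rule finite_subset[of _ "{..<a}"]) auto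
  ultimately have "finite ?L" using finite_imageD by blast
  then show "finite {F. dom F = row_diagram off m r \<and> ran F \<subseteq> ?L}"
    by (intro finite_set_of_finite_maps) auto
  show "tableaux off m Adm a r \<subseteq> {F. dom F = row_diagram off m r \<and> ran F \<subseteq> ?L}"
    by (auto simp: tableaux_def ran_def)
qed

lemma steps_decreasing:
  fixes r :: "nat \<Rightarrow> nat"
  assumes "\<forall>i. 1 \<le> i \<longrightarrow> i < m \<longrightarrow> r (Suc i) \<le> r i" "1 \<le> i" "i \<le> i'" "i' \<le> m"
  shows "r i' \<le> r i"
  using assms(3,4)
proof (induction i' rule: dec_induct)
  case base show ?case by simp
next
  case (step k)
  then show ?case using assms(1,2) by (meson Suc_leD Suc_le_eq le_trans)
qed

lemma initial_segment_eq:
  fixes S :: "nat set"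
  assumes S: "S \<subseteq> {o'<..t}" and down: "\<And>j j'. j \<in> S \<Longrightarrow> o' < j' \<Longrightarrow> j' \<le> j \<Longrightarrow> j' \<in> S"
  shows "S = {o'<..o' + card S}"
proof (cases "S = {}")
  case False
  have fin: "finite S" using S finite_subset by blast
  then have "S = {o'<..Max S}"
    using S down[OF Max_in[OF fin False]] Max_ge[OF fin] by fastforce
  moreover from this have "card S = Max S - o'" by (metis card_greaterThanAtMost)
  moreover have "o' < Max S" using S Max_in[OF fin False] by auto
  ultimately show ?thesis by simp
qed auto

text \<open>The last assumption says that no row can lose so many boxes that it ends before the next row
  starts; for shifted shapes this expresses the condition on the diagonal.\<close>

locale peeling =
  fixes off :: "nat \<Rightarrow> nat" and m :: nat and Adm :: "nat \<times> nat \<Rightarrow> letter \<Rightarrow> bool"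
    and e :: letter and r :: "nat \<Rightarrow> nat"
  assumes off_mono: "mono off" and shape: "row_shape off m r"
    and adm_first: "\<And>i j. 1 \<le> i \<Longrightarrow> i < m \<Longrightarrow> off i < j \<Longrightarrow> j \<le> off (Suc i) \<Longrightarrow> \<not> Adm (i, j) e"
begin

abbreviation "a \<equiv> letter_rank e"

lemma r_decreasing: "1 \<le> i \<Longrightarrow> i \<le> i' \<Longrightarrow> i' \<le> m \<Longrightarrow> r i' \<le> r i"
  using shape steps_decreasing[of m r i i'] by (simp add: row_shape_def)

section \<open>Cutting a tableau before its largest letter\<close>

context
  fixes F assumes F: "F \<in> tableaux off m Adm (Suc a) r"
begin

lemma F_facts:
  shows F_dom: "dom F = row_diagram off m r"
    and F_adm: "\<And>b x. F b = Some x \<Longrightarrow> Adm b x"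
    and F_rank: "\<And>b x. F b = Some x \<Longrightarrow> letter_rank x < Suc a"
    and F_row: "\<And>i j j' x y. j \<le> j' \<Longrightarrow> F (i, j) = Some x \<Longrightarrow> F (i, j') = Some y \<Longrightarrow> letter_rank x \<le> letter_rank y"
    and F_col: "\<And>i i' j x y. i \<le> i' \<Longrightarrow> F (i, j) = Some x \<Longrightarrow> F (i', j) = Some y \<Longrightarrow> letter_rank x \<le> letter_rank y"
    and F_unprimed: "no_unprimed_twice_in_column F" and F_primed: "no_primed_twice_in_row F"
proof -
  fix i j j' x y assume "j \<le> j'" "F (i, j) = Some x" "F (i, j') = Some y"
  then show "letter_rank x \<le> letter_rank y"
    using F by (cases "j < j'") (auto simp: tableaux_def rows_weakly_increase_def less_eq_letter_def)
next
  fix i i' j x y assume "i \<le> i'" "F (i, j) = Some x" "F (i', j) = Some y"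
  then show "letter_rank x \<le> letter_rank y"
    using F by (cases "i < i'") (auto simp: tableaux_def columns_weakly_increase_def less_eq_letter_def)
qed (use F in \<open>auto simp: tableaux_def\<close>)

lemma below_subset: "below a F \<subseteq> row_diagram off m r"
  unfolding F_dom[symmetric] by (auto simp: below_def)

lemma F_some: "1 \<le> i \<Longrightarrow> i \<le> m \<Longrightarrow> off i < j \<Longrightarrow> j \<le> r i \<Longrightarrow> \<exists>x. F (i, j) = Some x"
  using F_dom by (metis domD mem_row_diagram)

text \<open>Rows increase weakly, so the boxes with letters below \<open>e\<close> are closed to the
  left, and such a set is an interval fixed by its size.\<close>

lemma row_below: "1 \<le> i \<Longrightarrow> i \<le> m \<Longrightarrow> {j. (i, j) \<in> below a F} = {off i<..row_cut off m a F i}"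
proof -
  assume i: "1 \<le> i" "i \<le> m"
  let ?S = "{j. (i, j) \<in> below a F}"
  have "?S = {off i<..off i + card ?S}"
  proof (rule initial_segment_eq)
    show "?S \<subseteq> {off i<..r i}" using below_subset by auto
    fix j j' assume "j \<in> ?S" "off i < j'" "j' \<le> j"
    moreover from this obtain x where x: "F (i, j) = Some x" "letter_rank x < a"
      by (auto simp: below_def)
    moreover have "j \<le> r i" using calculation below_subset by auto
    ultimately obtain y where "F (i, j') = Some y" using F_some[of i j'] i by auto
    with F_row[OF \<open>j' \<le> j\<close> this x(1)] x(2) show "j' \<in> ?S" by (auto simp: below_def)
  qed
  then show ?thesis using i by (simp add: row_cut_def)
qed

lemma mem_below: "(i, j) \<in> below a F \<longleftrightarrow> 1 \<le> i \<and> i \<le> m \<and> off i < j \<and> j \<le> row_cut off m a F i"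
  using row_below[of i] below_subset by (cases "1 \<le> i \<and> i \<le> m") auto

lemma below_eq: "below a F = row_diagram off m (row_cut off m a F)"
  by (auto simp: mem_below)

lemma row_cut_bounds: "1 \<le> i \<Longrightarrow> i \<le> m \<Longrightarrow> off i \<le> row_cut off m a F i \<and> row_cut off m a F i \<le> r i"
proof -
  assume i: "1 \<le> i" "i \<le> m"
  let ?k = "row_cut off m a F i"
  have "off i \<le> ?k" using i by (simp add: row_cut_def)
  moreover have "?k \<le> r i"
  proof (cases "off i = ?k")
    case True then show ?thesis using i shape by (metis atLeastAtMost_iff row_shape_def)
  next
    case False
    then have "(i, ?k) \<in> below a F" using i \<open>off i \<le> ?k\<close> by (simp add: mem_below)
    then show ?thesis using below_subset by auto
  qed
  ultimately show ?thesis by simp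
qed

lemma F_top:
  assumes "1 \<le> i" "i \<le> m" "row_cut off m a F i < j" "j \<le> r i"
  shows "F (i, j) = Some e"
proof -
  have "off i < j" using row_cut_bounds[of i] assms by auto
  then obtain x where x: "F (i, j) = Some x" using F_some assms by blast
  have "(i, j) \<notin> below a F" using assms by (simp add: mem_below)
  then have "letter_rank x = a" using x F_rank[OF x] by (auto simp: below_def)
  then show ?thesis using x letter_rank_inject by simp
qed

text \<open>Otherwise the box just after the cut contains \<open>e\<close> in a column where
  \<open>adm_first\<close> forbids it. For shifted shapes this is the diagonal box.\<close>

lemma off_Suc_le_row_cut: "1 \<le> i \<Longrightarrow> i < m \<Longrightarrow> off (Suc i) \<le> row_cut off m a F i"
proof (rule ccontr)
  assume i: "1 \<le> i" "i < m" and "\<not> off (Suc i) \<le> row_cut off m a F i"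
  then have lt: "row_cut off m a F i < off (Suc i)" by simp
  let ?j = "Suc (row_cut off m a F i)"
  have "off (Suc i) \<le> r (Suc i)" using row_cut_bounds[of "Suc i"] i by auto
  then have "?j \<le> r i" using lt r_decreasing[of i "Suc i"] i by auto
  then have "Adm (i, ?j) e" using i by (intro F_adm F_top) auto
  moreover have "off i < ?j" using row_cut_bounds[of i] i by auto
  ultimately show False using adm_first[of i ?j] i lt by simp
qed

lemma row_cut_decreasing: "1 \<le> i \<Longrightarrow> i < m \<Longrightarrow> row_cut off m a F (Suc i) \<le> row_cut off m a F i"
proof (rule ccontr)
  let ?k = "row_cut off m a F"
  assume i: "1 \<le> i" "i < m" and "\<not> ?k (Suc i) \<le> ?k i"
  then have lt: "?k i < ?k (Suc i)" by simp
  have le: "?k (Suc i) \<le> r i" using row_cut_bounds[of "Suc i"] r_decreasing[of i "Suc i"] i by auto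
  have "(Suc i, ?k (Suc i)) \<in> below a F" using i lt off_Suc_le_row_cut[of i] by (simp add: mem_below)
  then obtain y where "F (Suc i, ?k (Suc i)) = Some y" "letter_rank y < a"
    by (auto simp: below_def)
  moreover have "F (i, ?k (Suc i)) = Some e" using i lt le by (intro F_top) auto
  ultimately show False using F_col[of i "Suc i"] by fastforce
qed

lemma row_cut_primed: "primed e \<Longrightarrow> 1 \<le> i \<Longrightarrow> i \<le> m \<Longrightarrow> r i \<le> Suc (row_cut off m a F i)"
proof (rule ccontr)
  let ?k = "row_cut off m a F i"
  assume e: "primed e" and i: "1 \<le> i" "i \<le> m" and "\<not> r i \<le> Suc ?k"
  then have "F (i, Suc ?k) = Some e" "F (i, Suc (Suc ?k)) = Some e" by (auto intro: F_top)
  then have "Suc ?k = Suc (Suc ?k)" using F_primed e unfolding no_primed_twice_in_row_def by blast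
  then show False by simp
qed

text \<open>Otherwise column \<open>r (Suc i)\<close> contains \<open>e\<close> twice: in row
  \<open>i\<close> because it is past the cut, and below it because no letter is larger.\<close>

lemma row_cut_unprimed: "\<not> primed e \<Longrightarrow> 1 \<le> i \<Longrightarrow> i < m \<Longrightarrow> r (Suc i) \<le> row_cut off m a F i"
proof (rule ccontr)
  let ?k = "row_cut off m a F i"
  assume e: "\<not> primed e" and i: "1 \<le> i" "i < m" and "\<not> r (Suc i) \<le> ?k"
  then have lt: "?k < r (Suc i)" by simp
  have le: "r (Suc i) \<le> r i" using r_decreasing[of i "Suc i"] i by auto
  have 1: "F (i, r (Suc i)) = Some e" using i lt le by (intro F_top) auto
  obtain y where y: "F (Suc i, r (Suc i)) = Some y"
    using F_some[of "Suc i" "r (Suc i)"] i lt off_Suc_le_row_cut[of i] by auto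
  have "letter_rank y = a" using F_col[OF _ 1 y] F_rank[OF y] by simp
  then have "F (Suc i, r (Suc i)) = Some e" using y letter_rank_inject by simp
  with 1 have "i = Suc i" using F_unprimed e unfolding no_unprimed_twice_in_column_def by blast
  then show False by simp
qed

lemma row_cut_strip: "row_cut off m a F \<in> strips off m Adm e r"
proof -
  have "row_cut off m a F \<in> PiE {1..m} (\<lambda>i. {off i..r i})"
    using row_cut_bounds by (intro PiE_I) (auto simp: row_cut_def)
  moreover have "Adm (i, j) e" if "i \<in> {1..m}" "j \<in> {row_cut off m a F i<..r i}" for i j
    using that by (intro F_adm F_top) auto
  ultimately show ?thesis
    using row_cut_decreasing row_cut_primed row_cut_unprimed by (auto simp: strips_def)
qed

lemma restrict_below: "F |` below a F \<in> tableaux off m Adm a (row_cut off m a F)"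
proof -
  have "dom (F |` below a F) = row_diagram off m (row_cut off m a F)"
    unfolding below_eq[symmetric] by (auto simp: below_def)
  moreover have "Adm b x \<and> letter_rank x < a" if "(F |` below a F) b = Some x" for b x
    using that F_adm by (auto simp: restrict_map_def below_def split: if_splits)
  ultimately show ?thesis
    using F unfolding tableaux_def rows_weakly_increase_def columns_weakly_increase_def
      no_unprimed_twice_in_column_def no_primed_twice_in_row_def
    by (auto simp: restrict_map_def split: if_splits)
qed

lemma fill_strip_restrict: "fill_strip (row_diagram off m r) e (F |` below a F) = F"
proof
  fix b
  show "fill_strip (row_diagram off m r) e (F |` below a F) b = F b"
  proof (cases "F b")
    case None
    then have "b \<notin> row_diagram off m r" using F_dom by blast
    then show ?thesis using None by (auto simp: fill_strip_def restrict_map_def below_def)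
  next
    case (Some x)
    then have "b \<in> row_diagram off m r" using F_dom by blast
    moreover have "b \<notin> below a F \<Longrightarrow> x = e"
      using Some F_rank[OF Some] letter_rank_inject[of x e] by (auto simp: below_def)
    ultimately show ?thesis using Some by (auto simp: fill_strip_def restrict_map_def below_def)
  qed
qed

end

section \<open>Extending a tableau by a strip of the new letter\<close>

context
  fixes r' F' assumes r': "r' \<in> strips off m Adm e r" and F': "F' \<in> tableaux off m Adm a r'"
begin

abbreviation "G \<equiv> fill_strip (row_diagram off m r) e F'"

lemma r'_bounds: "1 \<le> i \<Longrightarrow> i \<le> m \<Longrightarrow> off i \<le> r' i \<and> r' i \<le> r i"
  using r' by (auto simp: strips_def PiE_iff)

lemma r'_decreasing: "1 \<le> i \<Longrightarrow> i \<le> i' \<Longrightarrow> i' \<le> m \<Longrightarrow> r' i' \<le> r' i"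
  using r' steps_decreasing[of m r' i i'] by (simp add: strips_def)

lemma F'_facts:
  shows F'_dom: "dom F' = row_diagram off m r'"
    and F'_adm: "\<And>b x. F' b = Some x \<Longrightarrow> Adm b x"
    and F'_rank: "\<And>b x. F' b = Some x \<Longrightarrow> letter_rank x < a"
  using F' by (auto simp: tableaux_def)

lemma F'_mem: "F' (i, j) = Some x \<Longrightarrow> 1 \<le> i \<and> i \<le> m \<and> off i < j \<and> j \<le> r' i"
  using F'_dom by (metis domI mem_row_diagram)

lemma G_cases:
  assumes "G (i, j) = Some x"
  shows "F' (i, j) = Some x \<and> letter_rank x < a \<or>
    x = e \<and> F' (i, j) = None \<and> 1 \<le> i \<and> i \<le> m \<and> off i < j \<and> r' i < j \<and> j \<le> r i"
proof (cases "F' (i, j)")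
  case None
  then have "(i, j) \<notin> row_diagram off m r'" using F'_dom by blast
  then show ?thesis using None assms by (auto simp: fill_strip_def split: if_splits)
next
  case (Some y)
  then show ?thesis using assms F'_rank[OF Some] by (auto simp: fill_strip_def domIff)
qed

lemma G_dom: "dom G = row_diagram off m r"
proof -
  have "row_diagram off m r' \<subseteq> row_diagram off m r"
    by (auto simp: le_trans[OF _ conjunct2[OF r'_bounds]])
  moreover have "dom G = dom F' \<union> row_diagram off m r"
    by (auto simp: fill_strip_def dom_def split: if_splits)
  ultimately show ?thesis using F'_dom by blast
qed

lemma below_G: "below a G = row_diagram off m r'"
proof -
  have "(i, j) \<in> below a G \<longleftrightarrow> (i, j) \<in> dom F'" for i j
  proof
    assume "(i, j) \<in> below a G"
    then show "(i, j) \<in> dom F'" using G_cases by (fastforce simp: below_def)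
  next
    assume "(i, j) \<in> dom F'"
    then show "(i, j) \<in> below a G" using F'_rank by (auto simp: below_def fill_strip_def)
  qed
  then show ?thesis unfolding F'_dom by auto
qed

lemma row_cut_G: "row_cut off m a G = r'"
proof
  fix i
  show "row_cut off m a G i = r' i"
  proof (cases "i \<in> {1..m}")
    case True
    then have "{j. (i, j) \<in> below a G} = {off i<..r' i}" by (auto simp: below_G)
    then show ?thesis using True r'_bounds[of i] by (simp add: row_cut_def)
  next
    case False
    then show ?thesis using r' by (auto simp: row_cut_def strips_def PiE_def extensional_def)
  qed
qed

lemma G_restrict: "G |` below a G = F'"
proof
  fix b show "(G |` below a G) b = F' b"
    unfolding below_G F'_dom[symmetric] by (cases "F' b") (auto simp: restrict_map_def fill_strip_def domIff)
qed

text \<open>The new boxes contain the largest letter, so the order could fail only where a new box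
  precedes an old one, which the shape of \<open>r'\<close> excludes. The strip condition excludes
  forbidden repetitions of \<open>e\<close>.\<close>

lemma G_tableau: "G \<in> tableaux off m Adm (Suc a) r"
proof -
  have adm: "Adm b x \<and> letter_rank x < Suc a" if "G b = Some x" for b x
  proof -
    obtain i j where b: "b = (i, j)" by fastforce
    from G_cases[OF that[unfolded b]] show ?thesis
    proof
      assume "F' (i, j) = Some x \<and> letter_rank x < a"
      then show ?thesis using F'_adm b by auto
    next
      assume "x = e \<and> F' (i, j) = None \<and> 1 \<le> i \<and> i \<le> m \<and> off i < j \<and> r' i < j \<and> j \<le> r i"
      then show ?thesis using r' b by (auto simp: strips_def)
    qed
  qed
  have row: "x \<le> y" if lt: "j < j'" and x: "G (i, j) = Some x" and y: "G (i, j') = Some y" for i j j' x y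
    using G_cases[OF x] G_cases[OF y]
  proof (elim disjE conjE)
    assume "F' (i, j) = Some x" "F' (i, j') = Some y"
    then show ?thesis using F' lt by (auto simp: tableaux_def rows_weakly_increase_def)
  next
    assume "r' i < j" "F' (i, j') = Some y"
    then show ?thesis using lt F'_mem[of i j' y] by simp
  qed (auto simp: less_eq_letter_def)
  have col: "x \<le> y" if lt: "i < i'" and x: "G (i, j) = Some x" and y: "G (i', j) = Some y" for i i' j x y
    using G_cases[OF x] G_cases[OF y]
  proof (elim disjE conjE)
    assume "F' (i, j) = Some x" "F' (i', j) = Some y"
    then show ?thesis using F' lt by (auto simp: tableaux_def columns_weakly_increase_def)
  next
    assume "r' i < j" "F' (i', j) = Some y" "1 \<le> i"
    then show ?thesis using lt F'_mem[of i' j y] r'_decreasing[of i i'] by simp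
  qed (auto simp: less_eq_letter_def)
  have unprimed: "i = i'" if x: "G (i, j) = Some x" and y: "G (i', j) = Some x" and p: "\<not> primed x" for i i' j x
    using G_cases[OF x] G_cases[OF y]
  proof (elim disjE conjE)
    assume "F' (i, j) = Some x" "F' (i', j) = Some x"
    then show ?thesis using F' p by (auto simp: tableaux_def no_unprimed_twice_in_column_def)
  next
    assume h: "x = e" "1 \<le> i" "i \<le> m" "r' i < j" "j \<le> r i" "1 \<le> i'" "i' \<le> m" "r' i' < j" "j \<le> r i'"
    have "False" if "1 \<le> k" "k < k'" "k' \<le> m" "r' k < j" "j \<le> r k'" for k k'
    proof -
      have "r (Suc k) \<le> r' k" using r' p h(1) that by (simp add: strips_def)
      then show False using r_decreasing[of "Suc k" k'] that by simp
    qed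
    then show ?thesis using h by (metis linorder_neqE_nat)
  qed auto
  have primed: "j = j'" if x: "G (i, j) = Some x" and y: "G (i, j') = Some x" and p: "primed x" for i j j' x
    using G_cases[OF x] G_cases[OF y]
  proof (elim disjE conjE)
    assume "F' (i, j) = Some x" "F' (i, j') = Some x"
    then show ?thesis using F' p by (auto simp: tableaux_def no_primed_twice_in_row_def)
  next
    assume h: "x = e" "1 \<le> i" "i \<le> m" "r' i < j" "j \<le> r i" "r' i < j'" "j' \<le> r i"
    then have "r i \<le> Suc (r' i)" using r' p by (simp add: strips_def)
    then show ?thesis using h by simp
  qed auto
  have "rows_weakly_increase G" unfolding rows_weakly_increase_def using row by blast
  moreover have "columns_weakly_increase G" unfolding columns_weakly_increase_def using col by blast
  moreover have "no_unprimed_twice_in_column G"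
    unfolding no_unprimed_twice_in_column_def using unprimed by blast
  moreover have "no_primed_twice_in_row G" unfolding no_primed_twice_in_row_def using primed by blast
  ultimately show ?thesis using G_dom adm unfolding tableaux_def by simp
qed

lemma weight_G: "weight z G = (\<Prod>i=1..m. z e ^ (r i - r' i)) * weight z F'"
proof -
  have sub: "row_diagram off m r' \<subseteq> row_diagram off m r"
    by (auto simp: le_trans[OF _ conjunct2[OF r'_bounds]])
  have new: "row_diagram off m r - row_diagram off m r' = (SIGMA i:{1..m}. {r' i<..r i})"
    by (auto simp: le_less_trans[OF conjunct1[OF r'_bounds]])
  have "weight z G = (\<Prod>b\<in>row_diagram off m r - row_diagram off m r'. z (the (G b))) *
      (\<Prod>b\<in>row_diagram off m r'. z (the (G b)))"
    unfolding weight_def G_dom by (rule prod.subset_diff[OF sub]) simp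
  also have "(\<Prod>b\<in>row_diagram off m r'. z (the (G b))) = weight z F'"
    unfolding weight_def F'_dom[symmetric] by (intro prod.cong) (auto simp: fill_strip_def)
  also have "(\<Prod>b\<in>row_diagram off m r - row_diagram off m r'. z (the (G b))) =
      (\<Prod>b\<in>row_diagram off m r - row_diagram off m r'. z e)"
    using F'_dom by (intro prod.cong) (auto simp: fill_strip_def)
  also have "\<dots> = (\<Prod>i=1..m. z e ^ (r i - r' i))"
    unfolding new using prod.Sigma[of "{1..m}" "\<lambda>i. {r' i<..r i}" "\<lambda>_ _. z e"]
    by (simp add: case_prod_beta')
  finally show ?thesis .
qed

end

text \<open>Cutting off \<open>e\<close> and filling a strip with it are inverse to each other, and
  each box of the strip contributes a factor \<open>z e\<close>.\<close>

lemma tableau_sum_peel: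
  "tableau_sum z off m Adm (Suc a) r =
    (\<Sum>r'\<in>strips off m Adm e r. (\<Prod>i=1..m. z e ^ (r i - r' i)) * tableau_sum z off m Adm a r')"
proof -
  have "finite (PiE {1..m} (\<lambda>i. {off i..r i}))" by (intro finite_PiE) auto
  then have fin: "finite (strips off m Adm e r)" by (simp add: strips_def)
  have "(\<Sum>r'\<in>strips off m Adm e r. (\<Prod>i=1..m. z e ^ (r i - r' i)) * tableau_sum z off m Adm a r') =
      (\<Sum>(r', F')\<in>(SIGMA r':strips off m Adm e r. tableaux off m Adm a r').
        (\<Prod>i=1..m. z e ^ (r i - r' i)) * weight z F')"
    unfolding tableau_sum_def sum_distrib_left by (subst sum.Sigma[OF fin]) auto
  also have "\<dots> = tableau_sum z off m Adm (Suc a) r"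
    unfolding tableau_sum_def
    by (rule sum.reindex_bij_witness[where
        i = "\<lambda>F. (row_cut off m a F, F |` below a F)" and
        j = "\<lambda>(r', F'). fill_strip (row_diagram off m r) e F'"])
      (auto simp: row_cut_G G_restrict G_tableau weight_G row_cut_strip restrict_below fill_strip_restrict)
  finally show ?thesis by simp
qed

end

section \<open>Tableau sums as determinants\<close>

lemma series_mat_cong:
  assumes "\<And>i j. i < m \<Longrightarrow> j < m \<Longrightarrow>
    fps_nth (g j) (r (Suc i) + c - Suc i) = fps_nth (g' j) (r' (Suc i) + c' - Suc i)"
  shows "series_mat g c m r = series_mat g' c' m r'"
  using assms by (auto simp: series_mat_def)

text \<open>The generating series for the copies of one letter in a single row: any number if it is
  unprimed, at most one if it is primed.\<close>

definition letter_series :: "(letter \<Rightarrow> 'a::field) \<Rightarrow> letter \<Rightarrow> 'a fps" where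
  "letter_series z e = (if primed e then 1 + fps_const (z e) * fps_X
     else inverse (1 - fps_const (z e) * fps_X))"

text \<open>The induction step common to both families. By \<open>adm_first\<close> and
  \<open>adm_new\<close>, in a row \<open>i < m\<close> the letter \<open>e\<close> fits exactly in
  the columns past \<open>off (Suc i)\<close>. \<open>off_c\<close> puts an empty last row at
  position 0.\<close>

locale determinantal_peeling = peeling off m Adm e r
  for off :: "nat \<Rightarrow> nat" and m :: nat and Adm :: "nat \<times> nat \<Rightarrow> letter \<Rightarrow> bool"
    and e :: letter and r :: "nat \<Rightarrow> nat" +
  fixes z :: "letter \<Rightarrow> 'a::field" and g :: "nat \<Rightarrow> 'a fps" and c :: nat
  assumes adm_new: "\<And>i j. 1 \<le> i \<Longrightarrow> i \<le> m \<Longrightarrow> off i < j \<Longrightarrow> (i < m \<Longrightarrow> off (Suc i) < j) \<Longrightarrow> Adm (i, j) e"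
    and pos: "0 < m" and off_c: "off m + c = m"
    and shifted: "primed e \<Longrightarrow> \<forall>i\<in>{1..m}. off i = i - 1"
    and smaller: "\<And>r'. row_shape off m r' \<Longrightarrow>
      tableau_sum z off m Adm (letter_rank e) r' = det (series_mat g c m r')"
begin

lemma r_off: "1 \<le> i \<Longrightarrow> i \<le> m \<Longrightarrow> off i \<le> r i"
  using shape by (simp add: row_shape_def)

lemma strips_row_shape: "r' \<in> strips off m Adm e r \<Longrightarrow> row_shape off m r'"
  by (auto simp: strips_def row_shape_def PiE_iff)

text \<open>The interlacing inequalities imply all other conditions, so the row ends vary
  independently, as in the expansion of \<open>det_geometric_step\<close>.\<close>

lemma strips_unprimed:
  assumes "\<not> primed e"
  shows "strips off m Adm e r = PiE {1..m} (\<lambda>i. {(if i < m then r (Suc i) else off m)..r i})"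
    (is "_ = PiE {1..m} ?R")
proof (intro equalityI subsetI)
  fix r' assume "r' \<in> strips off m Adm e r"
  then show "r' \<in> PiE {1..m} ?R"
    using assms by (auto simp: strips_def PiE_iff)
next
  fix r' assume r': "r' \<in> PiE {1..m} ?R"
  have R: "r' i \<in> ?R i" if "1 \<le> i" "i \<le> m" for i
    using PiE_mem[OF r', of i] that by simp
  have lo: "off i \<le> r' i" "i < m \<Longrightarrow> off (Suc i) \<le> r' i" "r' i \<le> r i" if "1 \<le> i" "i \<le> m" for i
    using R[OF that] r_off[of "Suc i"] that monoD[OF off_mono, of i "Suc i"] by (auto split: if_splits)
  show "r' \<in> strips off m Adm e r"
    unfolding strips_def
  proof (intro CollectI conjI)
    show "r' \<in> PiE {1..m} (\<lambda>i. {off i..r i})"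
      using r' lo by (auto simp: PiE_iff)
    show "\<forall>i. 1 \<le> i \<longrightarrow> i < m \<longrightarrow> r' (Suc i) \<le> r' i"
    proof (intro allI impI)
      fix i assume "1 \<le> i" "i < m"
      then show "r' (Suc i) \<le> r' i" using R[of i] lo(3)[of "Suc i"] by simp
    qed
    have "r (Suc i) \<le> r' i" if "1 \<le> i" "i < m" for i using R[of i] that by simp
    then show "if primed e then \<forall>i\<in>{1..m}. r i \<le> Suc (r' i)
      else \<forall>i. 1 \<le> i \<longrightarrow> i < m \<longrightarrow> r (Suc i) \<le> r' i" using assms by simp
    show "\<forall>i\<in>{1..m}. \<forall>j\<in>{r' i<..r i}. Adm (i, j) e"
    proof (intro ballI adm_new)
      fix i j assume "i \<in> {1..m}" "j \<in> {r' i<..r i}"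
      then show "1 \<le> i" "i \<le> m" "off i < j" using lo(1)[of i] by auto
      assume "i < m"
      then show "off (Suc i) < j"
        using lo(2)[of i] \<open>i \<in> {1..m}\<close> \<open>j \<in> {r' i<..r i}\<close> by auto
    qed
  qed
qed

lemma strips_primed:
  assumes "primed e"
  shows "strips off m Adm e r = {r' \<in> PiE {1..m} (\<lambda>i. {max (i - 1) (r i - 1)..r i}).
        \<forall>i. 1 \<le> i \<longrightarrow> i < m \<longrightarrow> r' (Suc i) \<le> r' i}" (is "_ = ?S")
proof (intro equalityI subsetI)
  fix r' assume "r' \<in> strips off m Adm e r"
  then show "r' \<in> ?S"
    using assms shifted by (auto simp: strips_def PiE_iff)
next
  fix r' assume r': "r' \<in> ?S"
  then have "r' \<in> PiE {1..m} (\<lambda>i. {max (i - 1) (r i - 1)..r i})" by simp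
  then have "r' i \<in> {max (i - 1) (r i - 1)..r i}" if "1 \<le> i" "i \<le> m" for i
    by (rule PiE_mem) (use that in simp)
  then have R: "off i \<le> r' i" "r' i \<le> r i" "r i \<le> Suc (r' i)" if "1 \<le> i" "i \<le> m" for i
    using shifted[OF assms] that by (simp_all add: le_diff_conv)
  have dec: "r' (Suc i) \<le> r' i" if "1 \<le> i" "i < m" for i using r' that by simp
  show "r' \<in> strips off m Adm e r"
    unfolding strips_def
  proof (intro CollectI conjI)
    show "r' \<in> PiE {1..m} (\<lambda>i. {off i..r i})"
      using r' R by (auto simp: PiE_iff)
    show "\<forall>i\<in>{1..m}. \<forall>j\<in>{r' i<..r i}. Adm (i, j) e"
    proof (intro ballI adm_new)
      fix i j assume "i \<in> {1..m}" "j \<in> {r' i<..r i}"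
      then show "1 \<le> i" "i \<le> m" "off i < j" using R(1)[of i] by auto
      assume "i < m"
      then show "off (Suc i) < j"
        using R(1)[of "Suc i"] dec[of i] \<open>i \<in> {1..m}\<close> \<open>j \<in> {r' i<..r i}\<close> by auto
    qed
  qed (use assms R dec in auto)
qed

text \<open>Peeling off \<open>e\<close> and expanding the determinant run over the same shapes with
  the same powers of \<open>z e\<close>, and the remaining sums agree by
  \<open>smaller\<close>.\<close>

lemma tableau_sum_step:
  "tableau_sum z off m Adm (Suc (letter_rank e)) r =
    det (series_mat (\<lambda>j. g j * letter_series z e) c m r)"
proof -
  have sum: "tableau_sum z off m Adm (Suc (letter_rank e)) r =
    (\<Sum>r'\<in>strips off m Adm e r. (\<Prod>i=1..m. z e ^ (r i - r' i)) * det (series_mat g c m r'))"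
    unfolding tableau_sum_peel by (intro sum.cong refl) (simp add: smaller strips_row_shape)
  have dec: "r (Suc i) \<le> r i" if "1 \<le> i" "i < m" for i
    using shape that by (simp add: row_shape_def)
  show ?thesis
  proof (cases "primed e")
    case True
    have c: "c = 1" using shifted[OF True] off_c pos by auto
    have "i \<le> Suc (r i)" if "1 \<le> i" "i \<le> m" for i
      using r_off[OF that] shifted[OF True] that by auto
    then have "det (series_mat (\<lambda>j. g j * letter_series z e) 1 m r) =
      (\<Sum>r'\<in>strips off m Adm e r. (\<Prod>i=1..m. z e ^ (r i - r' i)) * det (series_mat g 1 m r'))"
      unfolding strips_primed[OF True]
      by (intro det_linear_step dec) (simp_all add: letter_series_def True)
    then show ?thesis using sum c by simp
  next
    case False
    have "inverse (1 - fps_const (z e) * fps_X) * (1 - fps_const (z e) * fps_X) = 1"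
      by (rule inverse_mult_eq_1) simp
    then have "g j * letter_series z e * (1 - fps_const (z e) * fps_X) = g j" for j
      by (simp add: letter_series_def False mult.assoc)
    then have "det (series_mat (\<lambda>j. g j * letter_series z e) c m r) =
      (\<Sum>r'\<in>strips off m Adm e r. (\<Prod>i=1..m. z e ^ (r i - r' i)) * det (series_mat g c m r'))"
      unfolding strips_unprimed[OF False]
      by (intro det_geometric_step dec) (use off_c r_off pos in auto)
    then show ?thesis using sum by simp
  qed
qed

end

section \<open>Adding a row for a new index\<close>

lemma row_shape_SucD: "row_shape off (Suc m) r \<Longrightarrow> row_shape off m r"
  by (auto simp: row_shape_def)

text \<open>The new column is the constant series 1. Earlier rows have positive positions, so only
  the last row can meet its coefficient, and it does so exactly when it is empty.\<close>

lemma det_new_row: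
  assumes shape: "row_shape off (Suc m) r" and off: "off (Suc m) + c' = Suc m"
    and old: "\<And>i j. i < m \<Longrightarrow> j < m \<Longrightarrow>
      fps_nth (g' j) (r (Suc i) + c' - Suc i) = fps_nth (g j) (r (Suc i) + c - Suc i)"
    and new: "g' m = 1"
  shows "det (series_mat g' c' (Suc m) r) =
    (if r (Suc m) = off (Suc m) then det (series_mat g c m r) else 0)"
proof -
  have "off (Suc m) \<le> r (Suc i)" if "i < m" for i
    using shape that steps_decreasing[of "Suc m" r "Suc i" "Suc m"]
    by (auto simp: row_shape_def intro: le_trans)
  then have "r (Suc i) + c' - Suc i \<noteq> 0" if "i < m" for i
    using off that by fastforce
  then have "det (series_mat g' c' (Suc m) r) =
      series_mat g' c' (Suc m) r $$ (m, m) * det (series_mat g c m r)"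
    by (intro det_last_column_unit series_mat_carrier) (auto simp: series_mat_def old new)
  moreover have "off (Suc m) \<le> r (Suc m)" using shape by (auto simp: row_shape_def)
  then have "series_mat g' c' (Suc m) r $$ (m, m) = (if r (Suc m) = off (Suc m) then 1 else 0)"
    using off by (auto simp: series_mat_def new)
  ultimately show ?thesis by simp
qed

text \<open>A nonempty new row has a first box, where only ranks from \<open>a\<close> on are
  admissible. This parallels the vanishing in \<open>det_new_row\<close>.\<close>

lemma tableau_sum_new_row:
  assumes first: "\<And>x. Adm (Suc m, Suc (off (Suc m))) x \<Longrightarrow> a \<le> letter_rank x"
    and "off (Suc m) \<le> r (Suc m)"
  shows "tableau_sum z off (Suc m) Adm a r =
    (if r (Suc m) = off (Suc m) then tableau_sum z off m Adm a r else 0)"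
proof (cases "r (Suc m) = off (Suc m)")
  case True
  then have "row_diagram off (Suc m) r = row_diagram off m r"
    by (auto simp: row_diagram_def) (metis le_SucE not_le)
  then show ?thesis using True by (simp add: tableau_sum_def tableaux_def)
next
  case False
  have "tableaux off (Suc m) Adm a r = {}"
  proof (rule ccontr)
    assume "tableaux off (Suc m) Adm a r \<noteq> {}"
    then obtain F where F: "F \<in> tableaux off (Suc m) Adm a r" by auto
    have "(Suc m, Suc (off (Suc m))) \<in> dom F"
      using F False assms(2) by (auto simp: tableaux_def simp del: domIff)
    then obtain x where "F (Suc m, Suc (off (Suc m))) = Some x" by blast
    then show False using F first by (fastforce simp: tableaux_def)
  qed
  then show ?thesis using False by (simp add: tableau_sum_def)
qed

lemma tableau_sum_no_rows: "tableau_sum z off 0 Adm a r = 1"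
proof -
  have "tableaux off 0 Adm a r = {Map.empty}"
    by (auto simp: tableaux_def row_diagram_def rows_weakly_increase_def columns_weakly_increase_def
      no_unprimed_twice_in_column_def no_primed_twice_in_row_def)
  then show ?thesis by (simp add: tableau_sum_def weight_def)
qed

text \<open>Serves for the primed letters, which symplectic tableaux do not contain.\<close>

lemma tableau_sum_skip:
  assumes "\<And>b x. Adm b x \<Longrightarrow> letter_rank x \<noteq> a"
  shows "tableau_sum z off m Adm (Suc a) r = tableau_sum z off m Adm a r"
proof -
  have "(Adm b x \<and> letter_rank x < Suc a) = (Adm b x \<and> letter_rank x < a)" for b x
    using assms less_Suc_eq by blast
  then have "tableaux off m Adm (Suc a) r = tableaux off m Adm a r"
    by (simp add: tableaux_def)
  then show ?thesis by (simp add: tableau_sum_def)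
qed

section \<open>Shifted and symplectic tableaux\<close>

text \<open>\<open>1 \<le> idx x\<close> excludes the letters of index 0, which the upper bound on
  ranks lets through.\<close>

definition diagonal_adm :: "nat \<times> nat \<Rightarrow> letter \<Rightarrow> bool" where
  "diagonal_adm b x \<longleftrightarrow> 1 \<le> idx x \<and> (fst b = snd b \<longrightarrow> idx x = fst b)"

definition symplectic_adm :: "nat \<times> nat \<Rightarrow> letter \<Rightarrow> bool" where
  "symplectic_adm b x \<longleftrightarrow> \<not> primed x \<and> fst b \<le> idx x"

definition shifted_level_series :: "(letter \<Rightarrow> 'a::field) \<Rightarrow> nat \<Rightarrow> 'a fps" where
  "shifted_level_series z k = letter_series z (barprimeL k) * letter_series z (barL k) *
     letter_series z (primeL k) * letter_series z (plainL k)"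

definition level_series :: "(letter \<Rightarrow> 'a::field) \<Rightarrow> nat \<Rightarrow> 'a fps" where
  "level_series z k = letter_series z (barL k) * letter_series z (plainL k)"

lemma shifted_tableau_sum_step:
  assumes "\<And>r. row_shape (\<lambda>i. i - 1) (Suc k) r \<Longrightarrow>
      tableau_sum z (\<lambda>i. i - 1) (Suc k) diagonal_adm a r = det (series_mat g 1 (Suc k) r)"
    and "idx e = Suc k" and "letter_rank e = a" and "row_shape (\<lambda>i. i - 1) (Suc k) r"
  shows "tableau_sum z (\<lambda>i. i - 1) (Suc k) diagonal_adm (Suc a) r =
    det (series_mat (\<lambda>j. g j * letter_series z e) 1 (Suc k) r)"
proof -
  interpret determinantal_peeling "\<lambda>i. i - 1" "Suc k" diagonal_adm e r z g 1
  proof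
    show "mono (\<lambda>i::nat. i - 1)" by (intro monoI) simp
    fix i j assume "1 \<le> i" "i \<le> Suc k" "i - 1 < j" "i < Suc k \<Longrightarrow> Suc i - 1 < j"
    then show "diagonal_adm (i, j) e"
      using assms(2) by (cases "i < Suc k") (auto simp: diagonal_adm_def)
  qed (use assms in \<open>auto simp: diagonal_adm_def\<close>)
  show ?thesis using tableau_sum_step assms(3) by simp
qed

text \<open>Index \<open>k\<close> occupies the ranks \<open>4 * k\<close> to
  \<open>4 * k + 3\<close>, so the bound admits the indices up to \<open>k\<close>. A new index adds
  a row, together with the column of the empty product, and then takes four letter steps.\<close>

lemma shifted_tableau_sum:
  assumes "row_shape (\<lambda>i. i - 1) k r"
  shows "tableau_sum z (\<lambda>i. i - 1) k diagonal_adm (4 * k + 4) r =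
    det (series_mat (\<lambda>j. \<Prod>l\<in>{j<..k}. shifted_level_series z l) 1 k r)"
  using assms
proof (induction k arbitrary: r)
  case 0
  show ?case by (simp add: tableau_sum_no_rows series_mat_def)
next
  case (Suc k)
  let ?sh = "row_shape (\<lambda>i. i - 1) (Suc k)"
  let ?W = "tableau_sum z (\<lambda>i. i - 1) (Suc k) diagonal_adm"
  let ?g = "\<lambda>j. \<Prod>l\<in>{j<..k}. shifted_level_series z l"
  let ?f = "letter_series z"
  have 0: "?W (4 * k + 4) r = det (series_mat ?g 1 (Suc k) r)" if r: "?sh r" for r
  proof -
    have "?W (4 * k + 4) r =
        (if r (Suc k) = Suc k - 1 then tableau_sum z (\<lambda>i. i - 1) k diagonal_adm (4 * k + 4) r else 0)"
    proof (intro tableau_sum_new_row)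
      fix x assume "diagonal_adm (Suc k, Suc (Suc k - 1)) x"
      then show "4 * k + 4 \<le> letter_rank x" by (cases x) (auto simp: diagonal_adm_def)
    qed (use bspec[OF conjunct1[OF r[unfolded row_shape_def]], of "Suc k"] in simp)
    also have "\<dots> = det (series_mat ?g 1 (Suc k) r)"
      using Suc.IH[OF row_shape_SucD[OF r]]
      by (subst det_new_row[OF r, where g = ?g and c = 1]) auto
    finally show ?thesis .
  qed
  have 1: "?W (Suc (4 * k + 4)) r =
      det (series_mat (\<lambda>j. ?g j * ?f (barprimeL (Suc k))) 1 (Suc k) r)" if "?sh r" for r
    by (rule shifted_tableau_sum_step[OF 0 _ _ that]) simp_all
  have 2: "?W (Suc (Suc (4 * k + 4))) r =
      det (series_mat (\<lambda>j. ?g j * ?f (barprimeL (Suc k)) * ?f (barL (Suc k))) 1 (Suc k) r)"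
    if "?sh r" for r
    by (rule shifted_tableau_sum_step[OF 1 _ _ that]) simp_all
  have 3: "?W (Suc (Suc (Suc (4 * k + 4)))) r =
      det (series_mat (\<lambda>j. ?g j * ?f (barprimeL (Suc k)) * ?f (barL (Suc k)) * ?f (primeL (Suc k))) 1 (Suc k) r)"
    if "?sh r" for r
    by (rule shifted_tableau_sum_step[OF 2 _ _ that]) simp_all
  have "?W (Suc (Suc (Suc (Suc (4 * k + 4))))) r =
      det (series_mat (\<lambda>j. ?g j * ?f (barprimeL (Suc k)) * ?f (barL (Suc k)) * ?f (primeL (Suc k)) *
        ?f (plainL (Suc k))) 1 (Suc k) r)"
    by (rule shifted_tableau_sum_step[OF 3 _ _ Suc.prems]) simp_all
  also have "series_mat (\<lambda>j. ?g j * ?f (barprimeL (Suc k)) * ?f (barL (Suc k)) * ?f (primeL (Suc k)) *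
        ?f (plainL (Suc k))) 1 (Suc k) r =
      series_mat (\<lambda>j. \<Prod>l\<in>{j<..Suc k}. shifted_level_series z l) 1 (Suc k) r"
  proof (rule series_mat_cong)
    fix i j assume "j < Suc k"
    then have "{j<..Suc k} = insert (Suc k) {j<..k}" by auto
    then have "(\<Prod>l\<in>{j<..Suc k}. shifted_level_series z l) =
        ?g j * ?f (barprimeL (Suc k)) * ?f (barL (Suc k)) * ?f (primeL (Suc k)) * ?f (plainL (Suc k))"
      by (simp add: shifted_level_series_def mult_ac)
    then show "fps_nth (?g j * ?f (barprimeL (Suc k)) * ?f (barL (Suc k)) * ?f (primeL (Suc k)) *
        ?f (plainL (Suc k))) (r (Suc i) + 1 - Suc i) =
      fps_nth (\<Prod>l\<in>{j<..Suc k}. shifted_level_series z l) (r (Suc i) + 1 - Suc i)" by (simp only:)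
  qed
  finally show ?case by simp
qed

lemma symplectic_tableau_sum_step:
  assumes "\<And>r. row_shape (\<lambda>i. 0) (Suc k) r \<Longrightarrow>
      tableau_sum z (\<lambda>i. 0) (Suc k) symplectic_adm a r = det (series_mat g (Suc k) (Suc k) r)"
    and "idx e = Suc k" and "\<not> primed e" and "letter_rank e = a" and "row_shape (\<lambda>i. 0) (Suc k) r"
  shows "tableau_sum z (\<lambda>i. 0) (Suc k) symplectic_adm (Suc a) r =
    det (series_mat (\<lambda>j. g j * letter_series z e) (Suc k) (Suc k) r)"
proof -
  interpret determinantal_peeling "\<lambda>i. 0" "Suc k" symplectic_adm e r z g "Suc k"
  proof
    show "mono (\<lambda>i::nat. 0::nat)" by (intro monoI) simp
  qed (use assms in \<open>auto simp: symplectic_adm_def\<close>)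
  show ?thesis using tableau_sum_step assms(4) by simp
qed

lemma symplectic_rank: "symplectic_adm b x \<Longrightarrow> odd (letter_rank x)"
  by (cases x) (auto simp: symplectic_adm_def)

lemma symplectic_tableau_sum:
  assumes "row_shape (\<lambda>i. 0) k r"
  shows "tableau_sum z (\<lambda>i. 0) k symplectic_adm (4 * k + 4) r =
    det (series_mat (\<lambda>j. fps_X ^ (k - Suc j) * (\<Prod>l\<in>{j<..k}. level_series z l)) k k r)"
  using assms
proof (induction k arbitrary: r)
  case 0
  show ?case by (simp add: tableau_sum_no_rows series_mat_def)
next
  case (Suc k)
  let ?sh = "row_shape (\<lambda>i. 0) (Suc k)"
  let ?W = "tableau_sum z (\<lambda>i. 0) (Suc k) symplectic_adm"
  let ?h = "\<lambda>j. fps_X ^ (k - Suc j) * (\<Prod>l\<in>{j<..k}. level_series z l)"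
  let ?g = "\<lambda>j. fps_X ^ (k - j) * (\<Prod>l\<in>{j<..k}. level_series z l)"
  let ?f = "letter_series z"
  have 0: "?W (4 * k + 4) r = det (series_mat ?g (Suc k) (Suc k) r)" if r: "?sh r" for r
  proof -
    have "?W (4 * k + 4) r =
        (if r (Suc k) = 0 then tableau_sum z (\<lambda>i. 0) k symplectic_adm (4 * k + 4) r else 0)"
    proof (intro tableau_sum_new_row)
      fix x assume "symplectic_adm (Suc k, Suc 0) x"
      then show "4 * k + 4 \<le> letter_rank x" by (cases x) (auto simp: symplectic_adm_def)
    qed simp
    also have "\<dots> = det (series_mat ?g (Suc k) (Suc k) r)"
    proof -
      \<comment> \<open>The shift \<open>c\<close> grows with the number of rows and raises all
        positions by one. A further factor q in the old columns compensates for this.\<close>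
      have "fps_nth (?g j) (r (Suc i) + Suc k - Suc i) = fps_nth (?h j) (r (Suc i) + k - Suc i)"
        if "i < k" "j < k" for i j
      proof -
        have "fps_X ^ (k - j) = (fps_X * fps_X ^ (k - Suc j) :: 'a fps)"
          using that by (simp add: Suc_diff_Suc flip: power_Suc)
        then have "?g j = fps_X * ?h j" by (simp only: mult.assoc)
        moreover have "r (Suc i) + Suc k - Suc i = Suc (r (Suc i) + k - Suc i)" using that by simp
        ultimately show ?thesis by (simp only: fps_X_mult_nth) simp
      qed
      then show ?thesis
        using Suc.IH[OF row_shape_SucD[OF r]]
        by (subst det_new_row[OF r, where g = ?h and c = k]) auto
    qed
    finally show ?thesis .
  qed
  have 1: "?W (Suc (4 * k + 4)) r = det (series_mat ?g (Suc k) (Suc k) r)" if "?sh r" for r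
    using 0[OF that] by (subst tableau_sum_skip) (use symplectic_rank in fastforce)+
  have 2: "?W (Suc (Suc (4 * k + 4))) r =
      det (series_mat (\<lambda>j. ?g j * ?f (barL (Suc k))) (Suc k) (Suc k) r)" if "?sh r" for r
    by (rule symplectic_tableau_sum_step[OF 1 _ _ _ that]) simp_all
  have 3: "?W (Suc (Suc (Suc (4 * k + 4)))) r =
      det (series_mat (\<lambda>j. ?g j * ?f (barL (Suc k))) (Suc k) (Suc k) r)" if "?sh r" for r
    using 2[OF that] by (subst tableau_sum_skip) (use symplectic_rank in fastforce)+
  have "?W (Suc (Suc (Suc (Suc (4 * k + 4))))) r =
      det (series_mat (\<lambda>j. ?g j * ?f (barL (Suc k)) * ?f (plainL (Suc k))) (Suc k) (Suc k) r)"
    by (rule symplectic_tableau_sum_step[OF 3 _ _ _ Suc.prems]) simp_all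
  also have "series_mat (\<lambda>j. ?g j * ?f (barL (Suc k)) * ?f (plainL (Suc k))) (Suc k) (Suc k) r =
      series_mat (\<lambda>j. fps_X ^ (Suc k - Suc j) * (\<Prod>l\<in>{j<..Suc k}. level_series z l)) (Suc k) (Suc k) r"
  proof (rule series_mat_cong)
    fix i j assume "j < Suc k"
    then have "{j<..Suc k} = insert (Suc k) {j<..k}" by auto
    then have "fps_X ^ (Suc k - Suc j) * (\<Prod>l\<in>{j<..Suc k}. level_series z l) =
        ?g j * ?f (barL (Suc k)) * ?f (plainL (Suc k))"
      by (simp add: level_series_def mult_ac)
    then show "fps_nth (?g j * ?f (barL (Suc k)) * ?f (plainL (Suc k))) (r (Suc i) + Suc k - Suc i) =
      fps_nth (fps_X ^ (Suc k - Suc j) * (\<Prod>l\<in>{j<..Suc k}. level_series z l)) (r (Suc i) + Suc k - Suc i)"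
      by (simp only:)
  qed
  finally show ?case by simp
qed

text \<open>Since the weights are inverse to each other, the two linear factors of each kind
  multiply to a quadratic with last coefficient 1, and \<open>det_quadratic_ratio\<close>
  applies.\<close>

lemma shifted_tableau_sum_factorization:
  fixes z :: "letter \<Rightarrow> 'a::field"
  assumes inv: "\<And>k. z (plainL k) * z (barL k) = 1" "\<And>k. z (primeL k) * z (barprimeL k) = 1"
    and part: "\<And>i. 1 \<le> i \<Longrightarrow> i < n \<Longrightarrow> l (Suc i) \<le> l i"
  shows "tableau_sum z (\<lambda>i. i - 1) n diagonal_adm (4 * n + 4) (\<lambda>i. l i + n) =
    (\<Prod>i=1..n. \<Prod>j=i..n. z (plainL i) + z (barL i) + (z (primeL j) + z (barprimeL j))) *
    tableau_sum z (\<lambda>i. 0) n symplectic_adm (4 * n + 4) l"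
proof -
  define X where "X k = z (plainL k) + z (barL k)" for k
  define Y where "Y k = z (primeL k) + z (barprimeL k)" for k
  have A: "(1 + fps_const (z (barprimeL k)) * fps_X) * (1 + fps_const (z (primeL k)) * fps_X) =
      1 + fps_const (Y k) * fps_X + fps_X ^ 2" for k
  proof -
    have "(1 + fps_const (z (barprimeL k)) * fps_X) * (1 + fps_const (z (primeL k)) * fps_X) =
      1 + fps_const (Y k) * fps_X + fps_const (z (primeL k) * z (barprimeL k)) * fps_X ^ 2"
      by (simp add: Y_def algebra_simps power2_eq_square flip: fps_const_add fps_const_mult)
    then show ?thesis by (simp add: inv)
  qed
  have B: "(1 - fps_const (z (barL k)) * fps_X) * (1 - fps_const (z (plainL k)) * fps_X) =
      1 - fps_const (X k) * fps_X + fps_X ^ 2" for k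
  proof -
    have "(1 - fps_const (z (barL k)) * fps_X) * (1 - fps_const (z (plainL k)) * fps_X) =
      1 - fps_const (X k) * fps_X + fps_const (z (plainL k) * z (barL k)) * fps_X ^ 2"
      by (simp add: X_def algebra_simps power2_eq_square flip: fps_const_add fps_const_mult)
    then show ?thesis by (simp add: inv)
  qed
  have H: "level_series z k = inverse (1 - fps_const (X k) * fps_X + fps_X ^ 2)" for k
    unfolding level_series_def B[symmetric] fps_inverse_mult by (simp add: letter_series_def)
  have F: "shifted_level_series z k = (1 + fps_const (Y k) * fps_X + fps_X ^ 2) * level_series z k" for k
    unfolding A[symmetric] shifted_level_series_def level_series_def
    by (simp add: letter_series_def mult_ac)
  have "row_shape (\<lambda>i. i - 1) n (\<lambda>i. l i + n)" "row_shape (\<lambda>i. 0) n l"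
    using part by (auto simp: row_shape_def)
  note W = shifted_tableau_sum[OF this(1)] symplectic_tableau_sum[OF this(2)]
  let ?p = "\<lambda>i. l (Suc i) + n - i"
  have "tableau_sum z (\<lambda>i. i - 1) n diagonal_adm (4 * n + 4) (\<lambda>i. l i + n) =
     det (mat n n (\<lambda>(i, j). fps_nth (\<Prod>k\<in>{j<..n}. (1 + fps_const (Y k) * fps_X + fps_X ^ 2) *
        inverse (1 - fps_const (X k) * fps_X + fps_X ^ 2)) (?p i)))"
    unfolding W series_mat_def F H by simp
  also have "\<dots> = (\<Prod>j<n. \<Prod>k\<in>{j<..n}. X (Suc j) + Y k) *
    det (mat n n (\<lambda>(i, j). fps_nth (fps_X ^ (n - j) * (\<Prod>k\<in>{j<..n}.
        inverse (1 - fps_const (X k) * fps_X + fps_X ^ 2))) (?p i)))"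
    by (rule det_quadratic_ratio) simp
  also have "mat n n (\<lambda>(i, j). fps_nth (fps_X ^ (n - j) * (\<Prod>k\<in>{j<..n}.
        inverse (1 - fps_const (X k) * fps_X + fps_X ^ 2))) (?p i)) =
      series_mat (\<lambda>j. fps_X ^ (n - Suc j) * (\<Prod>l\<in>{j<..n}. level_series z l)) n n l"
  proof (rule eq_matI)
    fix i j assume "i < dim_row (series_mat (\<lambda>j. fps_X ^ (n - Suc j) * (\<Prod>l\<in>{j<..n}. level_series z l)) n n l)"
      "j < dim_col (series_mat (\<lambda>j. fps_X ^ (n - Suc j) * (\<Prod>l\<in>{j<..n}. level_series z l)) n n l)"
    then have ij: "i < n" "j < n" by (simp_all add: series_mat_def)
    let ?P = "\<Prod>k\<in>{j<..n}. inverse (1 - fps_const (X k) * fps_X + fps_X ^ 2)"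
    have "fps_X ^ (n - j) = (fps_X * fps_X ^ (n - Suc j) :: 'a fps)"
      using ij by (simp add: Suc_diff_Suc flip: power_Suc)
    then have "fps_X ^ (n - j) * ?P = fps_X * (fps_X ^ (n - Suc j) * ?P)"
      by (simp only: mult.assoc)
    \<comment> \<open>The shifted positions exceed the symplectic ones by one, which accounts for
      the different powers of q.\<close>
    moreover have "?p i = Suc (l (Suc i) + n - Suc i)" using ij by simp
    ultimately have "fps_nth (fps_X ^ (n - j) * ?P) (?p i) =
        fps_nth (fps_X ^ (n - Suc j) * ?P) (l (Suc i) + n - Suc i)"
      by (simp only: fps_X_mult_nth) simp
    then show "mat n n (\<lambda>(i, j). fps_nth (fps_X ^ (n - j) * (\<Prod>k\<in>{j<..n}.
        inverse (1 - fps_const (X k) * fps_X + fps_X ^ 2))) (?p i)) $$ (i, j) =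
      series_mat (\<lambda>j. fps_X ^ (n - Suc j) * (\<Prod>l\<in>{j<..n}. level_series z l)) n n l $$ (i, j)"
      using ij by (simp add: series_mat_def H)
  qed (simp_all add: series_mat_def)
  also have "(\<Prod>j<n. \<Prod>k\<in>{j<..n}. X (Suc j) + Y k) =
      (\<Prod>i=1..n. \<Prod>j=i..n. z (plainL i) + z (barL i) + (z (primeL j) + z (barprimeL j)))"
    by (simp add: prod.atLeast1_atMost_eq X_def Y_def flip: atLeastSucAtMost_greaterThanAtMost)
  finally show ?thesis unfolding W .
qed

section \<open>Comparing weights\<close>

lemma letter_rank_less_iff: "letter_rank x < 4 * n + 4 \<longleftrightarrow> idx x \<le> n"
  by (cases x) auto

lemma letters_of_index: "x \<in> {barprimeL k, barL k, primeL k, plainL k} \<longleftrightarrow> idx x = k"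
  by (cases x) auto

lemma barL_le_iff: "\<not> primed x \<Longrightarrow> barL k \<le> x \<longleftrightarrow> k \<le> idx x"
  by (cases x) (auto simp: less_eq_letter_def)

lemma columns_strictly_increase_iff:
  assumes "\<forall>x\<in>ran F. \<not> primed x"
  shows "columns_strictly_increase F \<longleftrightarrow>
    columns_weakly_increase F \<and> no_unprimed_twice_in_column F"
proof
  assume F: "columns_strictly_increase F"
  then have "columns_weakly_increase F"
    unfolding columns_strictly_increase_def columns_weakly_increase_def by (meson less_imp_le)
  moreover have "i = i'" if "F (i, j) = Some x" "F (i', j) = Some x" for i i' j x
    using F that unfolding columns_strictly_increase_def by (metis less_irrefl linorder_neqE_nat)
  ultimately show "columns_weakly_increase F \<and> no_unprimed_twice_in_column F"
    unfolding no_unprimed_twice_in_column_def by blast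
next
  assume F: "columns_weakly_increase F \<and> no_unprimed_twice_in_column F"
  have "x < y" if h: "i < i'" "F (i, j) = Some x" "F (i', j) = Some y" for i i' j x y
  proof -
    have "x \<le> y" using F h unfolding columns_weakly_increase_def by blast
    moreover have "x \<noteq> y"
      using F h bspec[OF assms ranI[of F "(i, j)", OF h(2)]] unfolding no_unprimed_twice_in_column_def by fastforce
    ultimately show ?thesis by simp
  qed
  then show "columns_strictly_increase F" unfolding columns_strictly_increase_def by blast
qed

section \<open>Identification with the given sets of fillings\<close>

text \<open>Row \<open>i\<close> starts in column \<open>i\<close> and has
  \<open>part lam i + (Suc n - i)\<close> boxes, so it ends in column
  \<open>part lam i + n\<close>.\<close>

lemma QST_eq_tableaux:
  assumes "length lam \<le> n"
  shows "QST n (add_partition lam (staircase n)) =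
    tableaux (\<lambda>i. i - 1) n diagonal_adm (4 * n + 4) (\<lambda>i. part lam i + n)"
proof -
  let ?mu = "add_partition lam (staircase n)"
  have "shifted_diagram ?mu = row_diagram (\<lambda>i. i - 1) n (\<lambda>i. part lam i + n)"
    using part_add_staircase[OF assms] length_add_staircase[OF assms]
    by (auto simp: shifted_diagram_def)
  moreover have "ran F \<subseteq> alphabet n \<and>
        (\<forall>k x. F (k, k) = Some x \<longrightarrow> x \<in> {barprimeL k, barL k, primeL k, plainL k}) \<longleftrightarrow>
      (\<forall>b x. F b = Some x \<longrightarrow> diagonal_adm b x \<and> letter_rank x < 4 * n + 4)" for F
    unfolding letters_of_index letter_rank_less_iff
    by (auto simp: ran_def alphabet_def diagonal_adm_def)
  ultimately show ?thesis unfolding QST_def fillings_def tableaux_def by blast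
qed

text \<open>Without primed letters, strict columns are weak columns without repetition, and
  \<open>barL i \<le> x\<close> is a condition on the index only.\<close>

lemma ST_eq_tableaux:
  assumes "length lam \<le> n"
  shows "ST n lam = tableaux (\<lambda>i. 0) n symplectic_adm (4 * n + 4) (part lam)"
proof -
  have dg: "young_diagram lam = row_diagram (\<lambda>i. 0) n (part lam)"
    using assms by (auto simp: young_diagram_def Defs.part_def split: if_splits)
  have "F \<in> ST n lam \<longleftrightarrow> F \<in> tableaux (\<lambda>i. 0) n symplectic_adm (4 * n + 4) (part lam)" for F
  proof (cases "dom F = young_diagram lam \<and> (\<forall>b x. F b = Some x \<longrightarrow> \<not> primed x)")
    case True
    then have dom: "dom F = row_diagram (\<lambda>i. 0) n (part lam)"
      and unprimed: "\<And>b x. F b = Some x \<Longrightarrow> \<not> primed x" using dg by auto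
    have pos: "1 \<le> i" if "F (i, j) = Some x" for i j x
      using dom that by (metis domI mem_row_diagram)
    have up: "\<forall>x\<in>ran F. \<not> primed x" using unprimed by (auto simp: ran_def)
    have "barL i \<le> x \<and> x \<in> {x \<in> alphabet n. \<not> primed x} \<longleftrightarrow>
        symplectic_adm (i, j) x \<and> letter_rank x < 4 * n + 4" if "F (i, j) = Some x" for i j x
      using unprimed[OF that] pos[OF that]
      by (auto simp: letter_rank_less_iff alphabet_def symplectic_adm_def barL_le_iff simp del: letter_rank.simps)
    then have "ran F \<subseteq> {x \<in> alphabet n. \<not> primed x} \<and> (\<forall>i j x. F (i, j) = Some x \<longrightarrow> barL i \<le> x) \<longleftrightarrow>
        (\<forall>b x. F b = Some x \<longrightarrow> symplectic_adm b x \<and> letter_rank x < 4 * n + 4)"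
      unfolding ran_def subset_iff mem_Collect_eq split_paired_All split_paired_Ex by meson
    moreover have "no_primed_twice_in_row F"
      using unprimed by (auto simp: no_primed_twice_in_row_def)
    ultimately show ?thesis
      using dom dg columns_strictly_increase_iff[OF up]
      unfolding ST_def fillings_def tableaux_def by blast
  next
    case False
    then have "F \<notin> ST n lam" unfolding ST_def fillings_def by (blast intro: ranI)
    moreover have "F \<notin> tableaux (\<lambda>i. 0) n symplectic_adm (4 * n + 4) (part lam)"
      using False dg unfolding tableaux_def symplectic_adm_def by blast
    ultimately show ?thesis by blast
  qed
  then show ?thesis by blast
qed

lemma sum_weight_choices:
  fixes z :: "letter \<Rightarrow> 'a::comm_ring_1"
  assumes "finite B" and "\<And>b. b \<in> B \<Longrightarrow> finite (C b)"
  shows "(\<Sum>F | dom F = B \<and> (\<forall>b x. F b = Some x \<longrightarrow> x \<in> C b). weight z F) =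
    (\<Prod>b\<in>B. \<Sum>x\<in>C b. z x)"
proof -
  have "(\<Prod>b\<in>B. \<Sum>x\<in>C b. z x) = (\<Sum>g\<in>PiE B C. \<Prod>b\<in>B. z (g b))"
    by (rule prod_sum_PiE) (use assms in auto)
  also have "\<dots> = (\<Sum>F | dom F = B \<and> (\<forall>b x. F b = Some x \<longrightarrow> x \<in> C b). weight z F)"
  proof (rule sum.reindex_bij_witness[where i = "\<lambda>F. \<lambda>b\<in>B. the (F b)" and
        j = "\<lambda>g b. if b \<in> B then Some (g b) else None"])
    fix g assume g: "g \<in> PiE B C"
    then show "(\<lambda>b\<in>B. the (if b \<in> B then Some (g b) else None)) = g"
      by (auto simp: PiE_def extensional_def)
    show "(\<lambda>b. if b \<in> B then Some (g b) else None) \<in>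
        {F. dom F = B \<and> (\<forall>b x. F b = Some x \<longrightarrow> x \<in> C b)}"
      using g by (auto simp: dom_def)
    show "weight z (\<lambda>b. if b \<in> B then Some (g b) else None) = (\<Prod>b\<in>B. z (g b))"
      by (auto simp: weight_def dom_def)
  next
    fix F assume F: "F \<in> {F. dom F = B \<and> (\<forall>b x. F b = Some x \<longrightarrow> x \<in> C b)}"
    then show "(\<lambda>b. if b \<in> B then Some ((\<lambda>b\<in>B. the (F b)) b) else None) = F"
      by (fastforce simp: fun_eq_iff dom_def)
    show "(\<lambda>b\<in>B. the (F b)) \<in> PiE B C" using F by force
  qed
  finally show ?thesis by simp
qed

text \<open>The alphabet condition follows from the position of the box, which leaves an independent
  choice of letter in every box.\<close>

lemma QD_eq:
  "QD n = {F. dom F = shifted_diagram (staircase n) \<and>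
     (\<forall>b x. F b = Some x \<longrightarrow> x \<in> {plainL (fst b), barL (fst b), primeL (snd b), barprimeL (snd b)})}"
proof -
  have "ran F \<subseteq> alphabet n"
    if dom: "dom F = shifted_diagram (staircase n)" and
      F: "\<forall>i j x. F (i, j) = Some x \<longrightarrow> x \<in> {plainL i, barL i, primeL j, barprimeL j}" for F
  proof
    fix x assume "x \<in> ran F"
    then obtain i j where ij: "F (i, j) = Some x" by (auto simp: ran_def)
    then have "(i, j) \<in> shifted_diagram (staircase n)" using dom by blast
    then show "x \<in> alphabet n"
      using F ij by (fastforce simp: shifted_diagram_staircase alphabet_def)
  qed
  then show ?thesis unfolding QD_def fillings_def by auto
qed

lemma staircase_diagram:
  "shifted_diagram (staircase n) = row_diagram (\<lambda>i. i - 1) n (\<lambda>i. n)"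
  by (auto simp: shifted_diagram_staircase)

lemma letters_up_to: "{x. idx x \<le> n} = (\<lambda>(k, b, p). Letter k b p) ` ({..n} \<times> UNIV \<times> UNIV)"
proof (intro equalityI subsetI)
  fix x assume "x \<in> {x. idx x \<le> n}"
  then show "x \<in> (\<lambda>(k, b, p). Letter k b p) ` ({..n} \<times> UNIV \<times> UNIV)"
    by (intro image_eqI[of _ _ "(idx x, barred x, primed x)"]) auto
qed auto

lemma finite_QD: "finite (QD n)"
proof (rule finite_subset)
  have "finite {x. idx x \<le> n}" unfolding letters_up_to by simp
  then have "finite (alphabet n)" by (rule rev_finite_subset) (auto simp: alphabet_def)
  then show "finite {F. dom F = shifted_diagram (staircase n) \<and> ran F \<subseteq> alphabet n}"
    by (intro finite_set_of_finite_maps) (simp_all add: staircase_diagram)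
  show "QD n \<subseteq> {F. dom F = shifted_diagram (staircase n) \<and> ran F \<subseteq> alphabet n}"
    by (auto simp: QD_def fillings_def)
qed

lemma QD_sum:
  "(\<Sum>F\<in>QD n. weight z F) =
    (\<Prod>i=1..n. \<Prod>j=i..n. z (plainL i) + z (barL i) + (z (primeL j) + z (barprimeL j)))"
proof -
  have "(\<Sum>F\<in>QD n. weight z F) = (\<Prod>b\<in>shifted_diagram (staircase n).
      z (plainL (fst b)) + z (barL (fst b)) + (z (primeL (snd b)) + z (barprimeL (snd b))))"
    unfolding QD_eq by (subst sum_weight_choices) (simp_all add: staircase_diagram add.assoc)
  also have "shifted_diagram (staircase n) = (SIGMA i:{1..n}. {i..n})"
    by (auto simp: shifted_diagram_staircase)
  finally show ?thesis by (simp add: prod.Sigma case_prod_beta')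
qed

section \<open>Encoding weights by exponents\<close>

text \<open>The exponents of a single variable encode weights as numbers in base M, which determines them
  once M is large compared to the number of boxes.\<close>

definition code :: "int \<Rightarrow> letter \<Rightarrow> int" where
  "code M x = (if barred x then - 1 else 1) * M ^ (2 * idx x + (if primed x then 1 else 0))"

definition code_sum :: "int \<Rightarrow> filling \<Rightarrow> int" where
  "code_sum M F = (\<Sum>b\<in>dom F. code M (the (F b)))"

lemma weight_code: "weight (\<lambda>x. fls_X_intpow (code M x)) F = fls_X_intpow (code_sum M F)"
proof -
  have "(\<Prod>b\<in>A. fls_X_intpow (f b)) = (fls_X_intpow (\<Sum>b\<in>A. f b) :: 'a fls)" for A and f :: "nat \<times> nat \<Rightarrow> int"
    by (induction A rule: infinite_finite_induct) (auto simp: fls_X_intpow_times_fls_X_intpow)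
  then show ?thesis by (simp add: weight_def code_sum_def)
qed

lemma sum_entries:
  fixes f :: "letter \<Rightarrow> int"
  assumes fin: "finite (dom F)" and idx: "\<forall>x\<in>ran F. idx x \<le> n"
  shows "(\<Sum>b\<in>dom F. f (the (F b))) = (\<Sum>k\<le>n.
    int (num_entries F (plainL k)) * f (plainL k) + int (num_entries F (barL k)) * f (barL k) +
    int (num_entries F (primeL k)) * f (primeL k) + int (num_entries F (barprimeL k)) * f (barprimeL k))"
proof -
  let ?L = "(\<lambda>(k, b, p). Letter k b p) ` ({..n} \<times> UNIV \<times> UNIV)"
  have "(\<lambda>b. the (F b)) ` dom F \<subseteq> ?L"
    unfolding letters_up_to[symmetric] using idx by (auto intro: ranI)
  then have "(\<Sum>b\<in>dom F. f (the (F b))) = (\<Sum>x\<in>?L. \<Sum>b | b \<in> dom F \<and> the (F b) = x. f (the (F b)))"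
    using fin by (subst sum.group) auto
  also have "\<dots> = (\<Sum>x\<in>?L. int (num_entries F x) * f x)"
  proof (intro sum.cong refl)
    fix x
    have "{b. F b = Some x} = {b \<in> dom F. the (F b) = x}" by auto
    then show "(\<Sum>b | b \<in> dom F \<and> the (F b) = x. f (the (F b))) = int (num_entries F x) * f x"
      by (simp add: num_entries_def)
  qed
  also have "\<dots> = (\<Sum>(k, b, p)\<in>{..n} \<times> UNIV \<times> UNIV. int (num_entries F (Letter k b p)) * f (Letter k b p))"
    by (subst sum.reindex) (auto simp: inj_on_def case_prod_beta')
  also have "\<dots> = (\<Sum>k\<le>n. \<Sum>b\<in>UNIV. \<Sum>p\<in>UNIV. int (num_entries F (Letter k b p)) * f (Letter k b p))"
    by (simp add: sum.cartesian_product)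
  finally show ?thesis by (simp add: UNIV_bool add_ac)
qed

text \<open>The sign in \<open>code\<close> turns counts of letters into weight components, which
  become consecutive signed digits in base \<open>M\<close>.\<close>

lemma code_sum_wgt:
  assumes "finite (dom F)" "\<forall>x\<in>ran F. idx x \<le> n"
  shows "code_sum M F = (\<Sum>k\<le>n. (fst (wgt F) k + snd (wgt F) k * M) * (M\<^sup>2) ^ k)"
  unfolding code_sum_def sum_entries[OF assms, where f = "code M"]
proof (intro sum.cong refl)
  fix k
  have "code M (plainL k) = (M\<^sup>2) ^ k" "code M (barL k) = - ((M\<^sup>2) ^ k)"
    "code M (primeL k) = M * (M\<^sup>2) ^ k" "code M (barprimeL k) = - (M * (M\<^sup>2) ^ k)"
    by (simp_all add: code_def power_mult)
  then show "int (num_entries F (plainL k)) * code M (plainL k) + int (num_entries F (barL k)) * code M (barL k) +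
      int (num_entries F (primeL k)) * code M (primeL k) + int (num_entries F (barprimeL k)) * code M (barprimeL k) =
      (fst (wgt F) k + snd (wgt F) k * M) * (M\<^sup>2) ^ k"
    by (simp add: wgt_def algebra_simps)
qed

text \<open>An entry adds -1 to the sum of all weight components if it is barred and 1 otherwise. So
  size and weight determine \<open>bar_count\<close>.\<close>

lemma bar_count_wgt:
  assumes "finite (dom F)" "\<forall>x\<in>ran F. idx x \<le> n"
  shows "int (card (dom F)) - 2 * int (bar_count F) = (\<Sum>k\<le>n. fst (wgt F) k + snd (wgt F) k)"
proof -
  have bar: "{b. \<exists>x. F b = Some x \<and> barred x} = {b \<in> dom F. barred (the (F b))}" by auto
  have "int (bar_count F) = (\<Sum>b\<in>dom F. if barred (the (F b)) then 1 else 0)"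
    unfolding bar_count_def bar using assms(1) by (simp add: sum.If_cases Int_def)
  then have "int (card (dom F)) - 2 * int (bar_count F) =
      (\<Sum>b\<in>dom F. 1 - 2 * (if barred (the (F b)) then 1 else 0))"
    by (simp add: sum_subtractf sum_distrib_left)
  then show ?thesis
    using sum_entries[OF assms, where f = "\<lambda>x. 1 - 2 * (if barred x then 1 else 0)"]
    by (simp add: wgt_def algebra_simps)
qed

text \<open>\<open>B\<close> divides the lowest digit, which is smaller than \<open>B\<close> in
  absolute value and hence 0; dividing by \<open>B\<close> leaves a shorter sum.\<close>

lemma digits_eq_0:
  fixes a :: "nat \<Rightarrow> int"
  assumes "(\<Sum>k<m. a k * B ^ k) = 0" "\<And>k. k < m \<Longrightarrow> \<bar>a k\<bar> < B" "k < m"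
  shows "a k = 0"
  using assms
proof (induction m arbitrary: a k)
  case (Suc m)
  have eq: "(\<Sum>k<Suc m. a k * B ^ k) = a 0 + B * (\<Sum>k<m. a (Suc k) * B ^ k)"
    unfolding sum.lessThan_Suc_shift by (simp add: sum_distrib_left mult_ac)
  then have "B dvd a 0" using Suc.prems(1) by (metis add_eq_0_iff2 dvd_minus_iff dvd_triv_left)
  then have 0: "a 0 = 0" using Suc.prems(2)[of 0] zdvd_not_zless[of "\<bar>a 0\<bar>" B] by auto
  have "B \<noteq> 0" using Suc.prems(2)[of 0] by auto
  then have "(\<Sum>k<m. a (Suc k) * B ^ k) = 0" using eq Suc.prems(1) 0 by simp
  then have "a (Suc k) = 0" if "k < m" for k
    using Suc.IH[of "\<lambda>k. a (Suc k)" k] Suc.prems(2) that by auto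
  then show ?case using 0 Suc.prems(3) by (cases k) auto
qed simp

lemma double_digits_eq_0:
  fixes u v :: "nat \<Rightarrow> int"
  assumes "(\<Sum>k\<le>n. (u k + v k * M) * (M\<^sup>2) ^ k) = 0"
    and bound: "\<And>k. k \<le> n \<Longrightarrow> \<bar>u k\<bar> < M \<and> \<bar>v k\<bar> < M" and "k \<le> n"
  shows "u k = 0 \<and> v k = 0"
proof -
  have "\<bar>u k + v k * M\<bar> < M\<^sup>2" if "k \<le> n" for k
  proof -
    have b: "\<bar>u k\<bar> \<le> M - 1" "\<bar>v k\<bar> \<le> M - 1" "0 < M" using bound[OF that] by auto
    have "\<bar>u k + v k * M\<bar> \<le> \<bar>u k\<bar> + \<bar>v k\<bar> * M" using b(3) abs_triangle_ineq[of "u k" "v k * M"] by (simp add: abs_mult)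
    also have "\<dots> \<le> (M - 1) + (M - 1) * M" using b by (intro add_mono mult_right_mono) auto
    also have "\<dots> < M\<^sup>2" by (simp add: power2_eq_square algebra_simps)
    finally show ?thesis .
  qed
  then have "u k + v k * M = 0"
    using assms(1,3) digits_eq_0[of "\<lambda>k. u k + v k * M" "M\<^sup>2" "Suc n" k]
    by (simp add: lessThan_Suc_atMost)
  \<comment> \<open>Each digit in base \<open>M\<^sup>2\<close> is split into two digits in base
    \<open>M\<close>.\<close>
  then have "(\<Sum>i<2. (if i = 0 then u k else v k) * M ^ i) = 0" by (simp add: numeral_2_eq_2)
  from digits_eq_0[OF this, of 0] digits_eq_0[OF this, of 1] show ?thesis
    using bound[OF assms(3)] by auto
qed

section \<open>From equal generating functions to a bijection\<close>

text \<open>Fibres over the same value have equal size; arbitrary bijections between them are glued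
  together.\<close>

lemma bij_betw_of_fiber_card:
  assumes "finite A" "finite B"
    and card: "\<And>m. card {a \<in> A. f a = m} = card {b \<in> B. g b = m}"
  shows "\<exists>\<Phi>. bij_betw \<Phi> A B \<and> (\<forall>a\<in>A. g (\<Phi> a) = f a)"
proof -
  have "\<exists>h. bij_betw h {a \<in> A. f a = m} {b \<in> B. g b = m}" for m
    using assms by (intro finite_same_card_bij) auto
  then obtain h where h: "\<And>m. bij_betw (h m) {a \<in> A. f a = m} {b \<in> B. g b = m}" by metis
  define \<Phi> where "\<Phi> a = h (f a) a" for a
  have in_B: "\<Phi> a \<in> B \<and> g (\<Phi> a) = f a" if "a \<in> A" for a
    using bij_betwE[OF h[of "f a"]] that by (auto simp: \<Phi>_def)
  have "bij_betw \<Phi> A B"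
  proof (rule bij_betw_imageI)
    show "inj_on \<Phi> A"
    proof (rule inj_onI)
      fix a a' assume a: "a \<in> A" "a' \<in> A" "\<Phi> a = \<Phi> a'"
      then have "f a = f a'" using in_B by metis
      then show "a = a'"
        using a bij_betw_imp_inj_on[OF h[of "f a"]] by (auto simp: \<Phi>_def inj_on_def)
    qed
    show "\<Phi> ` A = B"
    proof (intro equalityI subsetI)
      fix b assume "b \<in> B"
      then have "b \<in> h (g b) ` {a \<in> A. f a = g b}"
        using bij_betw_imp_surj_on[OF h[of "g b"]] by auto
      then obtain a where a: "a \<in> A" "f a = g b" "b = h (g b) a" by auto
      have "b = \<Phi> a" unfolding \<Phi>_def a(2) by (rule a(3))
      then show "b \<in> \<Phi> ` A" using a(1) by (rule image_eqI)
    qed (use in_B in auto)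
  qed
  then show ?thesis using in_B by blast
qed

lemma num_entries_le: "finite (dom F) \<Longrightarrow> num_entries F x \<le> card (dom F)"
  unfolding num_entries_def by (intro card_mono) auto

lemma abs_wgt_le:
  assumes "finite (dom F)"
  shows "\<bar>fst (wgt F) k\<bar> \<le> int (card (dom F))" "\<bar>snd (wgt F) k\<bar> \<le> int (card (dom F))"
  using num_entries_le[OF assms, of "plainL k"] num_entries_le[OF assms, of "barL k"]
    num_entries_le[OF assms, of "primeL k"] num_entries_le[OF assms, of "barprimeL k"]
  by (auto simp: wgt_def)

lemma wgt_outside:
  assumes "\<forall>x\<in>ran F. idx x \<le> n" "n < k"
  shows "fst (wgt F) k = 0" "snd (wgt F) k = 0"
proof -
  have "num_entries F x = 0" if "idx x = k" for x
  proof -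
    have "x \<notin> ran F" using assms that by auto
    then have "{b. F b = Some x} = {}" unfolding ran_def by blast
    then show ?thesis unfolding num_entries_def by (simp only: card.empty)
  qed
  then show "fst (wgt F) k = 0" "snd (wgt F) k = 0" by (simp_all add: wgt_def)
qed

lemma card_row_diagram: "card (row_diagram off m r) = (\<Sum>i=1..m. r i - off i)"
  by (simp add: row_diagram_def)

text \<open>Rational coefficients have characteristic 0, so the size of a fibre can be recovered
  from the coefficient.\<close>

lemma fls_nth_sum_X_intpow:
  assumes "finite A"
  shows "fls_nth (\<Sum>a\<in>A. fls_X_intpow (f a)) m = (of_nat (card {a \<in> A. f a = m}) :: rat)"
proof -
  have "fls_nth (\<Sum>a\<in>A. fls_X_intpow (f a)) m = (\<Sum>a\<in>A. if f a = m then 1 else (0::rat))"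
    by (auto simp: fls_nth_sum intro!: sum.cong)
  then show ?thesis using assms by (simp add: sum.If_cases Int_def)
qed

theorem theorem2:
  fixes n :: nat and lam mu :: "nat list"
  assumes "1 \<le> n"
    and "is_partition lam" and "length lam \<le> n"
    and "mu = add_partition lam (staircase n)"
  shows "\<exists>\<Phi>. bij_betw \<Phi> (QST n mu) (QD n \<times> ST n lam) \<and>
    (\<forall>S \<in> QST n mu. \<forall>D T. \<Phi> S = (D, T) \<longrightarrow>
       wgt S = wgt D + wgt T \<and> bar_count S = bar_count D + bar_count T)"
proof -
  note QST = QST_eq_tableaux[OF assms(3), folded assms(4)] and ST = ST_eq_tableaux[OF assms(3)]
  define N where "N = (\<Sum>i=1..n. part lam i + n - (i - 1))"
  \<comment> \<open>\<open>N\<close> is the number of boxes of S, and of D and T together. So the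
    components of \<open>wgt S\<close> minus those of \<open>wgt D\<close> and \<open>wgt T\<close>
    are at most \<open>2 * N\<close> in absolute value, below \<open>M\<close>.\<close>
  define M where "M = 2 * int N + 1"
  define z :: "letter \<Rightarrow> rat fls" where "z x = fls_X_intpow (code M x)" for x
  have fin: "finite (QST n mu)" "finite (ST n lam)" by (simp_all add: QST ST)
  have inv: "z (plainL k) * z (barL k) = 1" "z (primeL k) * z (barprimeL k) = 1" for k
    unfolding z_def fls_X_intpow_times_fls_X_intpow by (simp_all add: code_def)
  have part: "part lam (Suc i) \<le> part lam i" if "1 \<le> i" for i
    using assms(2) that by (auto simp: Defs.part_def is_partition_def sorted_wrt_iff_nth_less)
  have "(\<Sum>S\<in>QST n mu. weight z S) = (\<Sum>D\<in>QD n. weight z D) * (\<Sum>T\<in>ST n lam. weight z T)"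
    using shifted_tableau_sum_factorization[where z = z and l = "part lam", OF inv part]
    unfolding QD_sum QST ST tableau_sum_def by simp
  also have "\<dots> = (\<Sum>(D, T)\<in>QD n \<times> ST n lam. weight z D * weight z T)"
    by (simp add: sum_product sum.cartesian_product)
  finally have gf: "(\<Sum>S\<in>QST n mu. fls_X_intpow (code_sum M S)) =
      (\<Sum>p\<in>QD n \<times> ST n lam. fls_X_intpow (code_sum M (fst p) + code_sum M (snd p)) :: rat fls)"
    unfolding z_def weight_code by (simp add: case_prod_beta' fls_X_intpow_times_fls_X_intpow)
  have fiber: "card {S \<in> QST n mu. code_sum M S = m} =
      card {p \<in> QD n \<times> ST n lam. code_sum M (fst p) + code_sum M (snd p) = m}" for m
    using arg_cong[OF gf, of "\<lambda>s. fls_nth s m"] fin finite_QD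
    by (simp only: fls_nth_sum_X_intpow finite_cartesian_product of_nat_eq_iff)
  obtain \<Phi> where \<Phi>: "bij_betw \<Phi> (QST n mu) (QD n \<times> ST n lam)"
    "\<forall>S\<in>QST n mu. code_sum M (fst (\<Phi> S)) + code_sum M (snd (\<Phi> S)) = code_sum M S"
    using bij_betw_of_fiber_card[where f = "code_sum M" and
        g = "\<lambda>p. code_sum M (fst p) + code_sum M (snd p)",
        OF fin(1) finite_cartesian_product[OF finite_QD fin(2)] fiber]
    by (elim exE conjE)
  have "wgt S = wgt D + wgt T \<and> bar_count S = bar_count D + bar_count T"
    if S: "S \<in> QST n mu" and eq: "\<Phi> S = (D, T)" for S D T
  proof -
    have D: "D \<in> QD n" and T: "T \<in> ST n lam" using bij_betwE[OF \<Phi>(1)] S eq by force+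
    have "ran S \<subseteq> alphabet n" "ran D \<subseteq> alphabet n" "ran T \<subseteq> alphabet n"
      using S D T unfolding QST_def QD_def ST_def fillings_def by blast+
    then have idx: "\<forall>x\<in>ran S. idx x \<le> n" "\<forall>x\<in>ran D. idx x \<le> n" "\<forall>x\<in>ran T. idx x \<le> n"
      by (auto simp: alphabet_def)
    have dom: "dom S = row_diagram (\<lambda>i. i - 1) n (\<lambda>i. part lam i + n)"
      "dom D = row_diagram (\<lambda>i. i - 1) n (\<lambda>i. n)" "dom T = row_diagram (\<lambda>i. 0) n (part lam)"
      using S D T unfolding QST ST QD_eq staircase_diagram tableaux_def by blast+
    then have fin: "finite (dom S)" "finite (dom D)" "finite (dom T)" by simp_all
    have "(\<Sum>i=1..n. part lam i + n - (i - 1)) = (\<Sum>i=1..n. n - (i - 1)) + (\<Sum>i=1..n. part lam i)"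
      unfolding sum.distrib[symmetric] by (intro sum.cong) auto
    then have card: "card (dom S) = N" "card (dom D) + card (dom T) = N"
      unfolding dom card_row_diagram N_def by simp_all
    define u where "u k = fst (wgt S) k - fst (wgt D) k - fst (wgt T) k" for k
    define v where "v k = snd (wgt S) k - snd (wgt D) k - snd (wgt T) k" for k
    have "(\<Sum>k\<le>n. (u k + v k * M) * (M\<^sup>2) ^ k) = code_sum M S - code_sum M D - code_sum M T"
      unfolding code_sum_wgt[OF fin(1) idx(1)] code_sum_wgt[OF fin(2) idx(2)] code_sum_wgt[OF fin(3) idx(3)]
      by (simp add: u_def v_def algebra_simps sum_subtractf sum.distrib)
    also have "\<dots> = 0" using bspec[OF \<Phi>(2) S] eq by simp
    finally have sum0: "(\<Sum>k\<le>n. (u k + v k * M) * (M\<^sup>2) ^ k) = 0" .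
    have "\<bar>u k\<bar> < M \<and> \<bar>v k\<bar> < M" for k
      using abs_wgt_le[OF fin(1), of k] abs_wgt_le[OF fin(2), of k] abs_wgt_le[OF fin(3), of k] card
      by (auto simp: u_def v_def M_def)
    then have "u k = 0 \<and> v k = 0" if "k \<le> n" for k
      using double_digits_eq_0[OF sum0 _ that] by blast
    \<comment> \<open>Indices above \<open>n\<close> occur in none of the three fillings.\<close>
    then have "u k = 0 \<and> v k = 0" for k
      using wgt_outside[OF idx(1), of k] wgt_outside[OF idx(2), of k] wgt_outside[OF idx(3), of k]
      by (cases "k \<le> n") (auto simp: u_def v_def)
    then have uv: "fst (wgt S) k = fst (wgt D) k + fst (wgt T) k"
      "snd (wgt S) k = snd (wgt D) k + snd (wgt T) k" for k
      by (auto simp: u_def v_def algebra_simps)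
    then have "wgt S = wgt D + wgt T" by (auto simp: prod_eq_iff fun_eq_iff)
    moreover have "int (card (dom S)) - 2 * int (bar_count S) = (int (card (dom D)) - 2 * int (bar_count D)) +
        (int (card (dom T)) - 2 * int (bar_count T))"
      unfolding bar_count_wgt[OF fin(1) idx(1)] bar_count_wgt[OF fin(2) idx(2)] bar_count_wgt[OF fin(3) idx(3)]
      by (simp add: uv sum.distrib)
    \<comment> \<open>Both sides have \<open>N\<close> boxes, so equal weights force equal numbers
      of bars.\<close>
    ultimately show ?thesis using card by linarith
  qed
  with \<Phi>(1) show ?thesis by blast
qed

end
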